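(* Let $n\ge2$. Let $(c_1,c_2)\in(\mathrm{Cl}_{0,n-1})^2$ be a solution of the quadratic Clifford equation $$\text{i)}\ (L_{c_1}-R_{c_2})^2E\subseteq E,\qquad \text{ii)}\ (L_{c_1}-R_{c_2})^2|_E=-B,$$ and let $c_3\in\mathrm{Cl}_{0,n-1}$. Every such triple $(c_1,c_2,c_3)$ defines a zero charge spin representation of the $(n+1)$-dimensional CW algebra $\mathfrak g_b=\mathfrak h+\mathfrak m=E^*+(E+\mathbb R\mathrm p+\mathbb R\mathrm q)$ given by $$\rho(e^\flat)=\sqrt2\begin{pmatrix}0&Be\\0&0\end{pmatrix},\qquad\rho(\mathrm p)=\begin{pmatrix}0&0\\0&0\end{pmatrix},$$ $$\rho(e)=\sqrt2\begin{pmatrix}0&e\cdot\circ\, c_2-c_1\circ e\cdot\\0&0\end{pmatrix},\qquad\rho(\mathrm q)=\begin{pmatrix}c_1&c_3\\0&c_2\end{pmatrix}\qquad(e\in E).$$ Every zero charge spin representation of $\mathfrak g_b$ is defined by such a triple, and two triples define the same representation if they differ by elements of the kernel (if it is non-trivial) of the Euclidean spin representation $\rho_{0,n-1}:\mathrm{Cl}_{0,n-1}\to\mathrm{End}_{\mathbb R}(S_{0,n-1})$.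
   Context: $E=\mathbb R^{0,n-1}$ is an $(n-1)$-dimensional real vector space with a negative definite inner product $\langle\cdot,\cdot\rangle$; $e^\flat=\langle e,\cdot\rangle\in E^*$. $b$ is a non-degenerate symmetric bilinear form on $E$ and $B\in\mathrm{End}_{\mathbb R}(E)$ is defined by $b(\cdot,\cdot)=-\langle B\cdot,\cdot\rangle$. $\mathfrak m=E+\mathbb R\mathrm p+\mathbb R\mathrm q$ is $(n+1)$-dimensional Minkowski space ($\mathrm p,\mathrm q$ isotropic, orthogonal to $E$, $\langle\mathrm p,\mathrm q\rangle=1$). The Cahen-Wallach (CW) algebra associated with $b$ is the Lie algebra $\mathfrak g_b=\mathfrak h+\mathfrak m=E^*+(E+\mathbb R\mathrm p+\mathbb R\mathrm q)$ whose only non-trivial brackets are $[\mathrm q,e]=e^\flat$, $[e^\flat,f]=b(e,f)\mathrm p$, $[e^\flat,\mathrm q]=B(e)$ ($e,f\in E$); following the paper it is called $(n+1)$-dimensional, referring to $\dim\mathfrak m$. $\mathrm{Cl}_{0,n-1}$ is the Clifford algebra of $E\subset\mathrm{Cl}_{0,n-1}$ with convention $v^2=-\langle v,v\rangle$; $L_c$, $R_c\in\mathrm{End}_{\mathbb R}(\mathrm{Cl}_{0,n-1})$ are left and right multiplication by $c$. $\rho_{0,n-1}:\mathrm{Cl}_{0,n-1}\to\mathrm{End}_{\mathbb R}(S_{0,n-1})$ is a real irreducible representation; inside matrices, an element $c\in\mathrm{Cl}_{0,n-1}$ or a vector $e\in E$ stands for its action on $S_{0,n-1}$. $\rho_{\mathrm{spin}}:\mathrm{Cl}(\mathfrak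 m)\to\mathrm{End}_{\mathbb R}(S)$, $S=S_{1,n}$, is the real irreducible $\mathrm{Cl}(\mathfrak m)$-module. Explicitly, via $\mathrm{Cl}(\mathfrak m)\cong\mathrm{Cl}_{1,1}\hat\otimes\mathrm{Cl}_{0,n-1}$ ($\mathrm{Cl}_{1,1}$ generated by $\mathrm p,\mathrm q$), $S=S_-+S_+=S_{0,n-1}+S_{0,n-1}$ as a vector space and, with $\alpha$ the parity automorphism of $\mathrm{Cl}_{0,n-1}$, $$1\otimes c\mapsto\begin{pmatrix}\alpha(c)&0\\0&c\end{pmatrix},\ \mathrm p\otimes c\mapsto\begin{pmatrix}0&2\sqrt2c\\0&0\end{pmatrix},\ \mathrm q\otimes c\mapsto\begin{pmatrix}0&0\\-\frac1{\sqrt2}\alpha(c)&0\end{pmatrix},\ \mathrm p\mathrm q\otimes c\mapsto\begin{pmatrix}-2\alpha(c)&0\\0&0\end{pmatrix}.$$ A representation $\rho:\mathfrak g_b\to\mathfrak{gl}_{\mathbb R}(S)$ is spin if $\rho(e^\flat)$ is the spin action of $\mathrm p\wedge Be\in\mathfrak{so}(\mathfrak m)$, i.e. $\rho(e^\flat)=\begin{pmatrix}0&\sqrt2\,Be\\0&0\end{pmatrix}$ for all $e\in E$. It has zero charge if $\rho(\mathrm p)=0$. By convention, for zero charge spin representations of the CW algebra the condition $\rho(\mathfrak m)\subseteq\rho_{\mathrm{spin}}(\mathrm{Cl}(\mathfrak m))$ is always assumed. *)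

theory Defs
  imports "HOL-Analysis.Analysis"
begin

section \<open>Spaces with a symmetric bilinear form\<close>

class form_space = real_vector +
  fixes sform :: "'a \<Rightarrow> 'a \<Rightarrow> real"
  assumes sform_commute: "sform x y = sform y x"
    and sform_add_left: "sform (x + y) z = sform x z + sform y z"
    and sform_scaleR_left: "sform (a *\<^sub>R x) y = a * sform x y"
begin

lemma sform_add_right: "sform x (y + z) = sform x y + sform x z"
  unfolding sform_commute[of x] by (rule sform_add_left)

lemma sform_scaleR_right: "sform x (a *\<^sub>R y) = a * sform x y"
  unfolding sform_commute[of x] by (rule sform_scaleR_left)

end

text \<open>The class of the spaces \<open>\<real>\<^sup>0\<^sup>,\<^sup>k\<close>: a Euclidean space whose form \<^const>\<open>sform\<close> is the
  negative of the positive definite inner product of the library.\<close>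

class neg_euclidean_space = euclidean_space + form_space +
  assumes sform_eq_minus_inner: "sform x y = - (x \<bullet> y)"

instantiation vec :: (euclidean_space, finite) neg_euclidean_space
begin

definition sform_vec :: "'a ^ 'b \<Rightarrow> 'a ^ 'b \<Rightarrow> real" where
  "sform_vec x y = - (x \<bullet> y)"

instance
proof
  fix x y z :: "'a ^ 'b" and a :: real
  show "sform x y = sform y x"
    unfolding sform_vec_def by (subst inner_commute) (rule refl)
  show "sform (x + y) z = sform x z + sform y z"
    unfolding sform_vec_def by (simp add: inner_add_left)
  show "sform (a *\<^sub>R x) y = a * sform x y"
    unfolding sform_vec_def by simp
  show "sform x y = - (x \<bullet> y)"
    by (rule sform_vec_def)
qed

end

text \<open>\<open>Mink e s t\<close> is the vector \<open>e + s p + t q\<close> of \<open>\<mm> = E + \<real>p + \<real>q\<close>.\<close>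

datatype 'e mink = Mink (e_part: 'e) (p_coeff: real) (q_coeff: real)

instantiation mink :: (real_vector) real_vector
begin

definition "0 = Mink 0 0 0"
definition "x + y = Mink (e_part x + e_part y) (p_coeff x + p_coeff y) (q_coeff x + q_coeff y)"
definition "- x = Mink (- e_part x) (- p_coeff x) (- q_coeff x)"
definition "x - y = Mink (e_part x - e_part y) (p_coeff x - p_coeff y) (q_coeff x - q_coeff y)"
definition "a *\<^sub>R x = Mink (a *\<^sub>R e_part x) (a * p_coeff x) (a * q_coeff x)"

instance
  by standard
    (simp_all add: zero_mink_def plus_mink_def uminus_mink_def minus_mink_def
      scaleR_mink_def algebra_simps)

end

lemma mink_simps [simp]:
  "Mink e s t + Mink f s' t' = Mink (e + f) (s + s') (t + t')"
  "- Mink e s t = Mink (- e) (- s) (- t)"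
  "Mink e s t - Mink f s' t' = Mink (e - f) (s - s') (t - t')"
  "a *\<^sub>R Mink e s t = Mink (a *\<^sub>R e) (a * s) (a * t)"
  by (simp_all add: plus_mink_def uminus_mink_def minus_mink_def scaleR_mink_def)

instantiation mink :: (form_space) form_space
begin

definition sform_mink :: "'a mink \<Rightarrow> 'a mink \<Rightarrow> real" where
  "sform_mink x y = sform (e_part x) (e_part y)
     + p_coeff x * q_coeff y + q_coeff x * p_coeff y"

instance
proof
  fix x y z :: "'a mink" and a :: real
  show "sform x y = sform y x"
    unfolding sform_mink_def sform_commute[of "e_part x" "e_part y"] by (simp add: mult.commute)
  show "sform (x + y) z = sform x z + sform y z"
    by (simp add: sform_mink_def plus_mink_def sform_add_left algebra_simps)
  show "sform (a *\<^sub>R x) y = a * sform x y"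
    by (simp add: sform_mink_def scaleR_mink_def sform_scaleR_left algebra_simps)
qed

end


section \<open>Clifford algebras\<close>

text \<open>The Clifford algebra of \<open>V\<close> is the unital associative real algebra generated by \<open>V\<close>,
  subject to linearity of \<open>V \<rightarrow> Cl(V)\<close> and to \<open>v\<^sup>2 = -\<langle>v,v\<rangle>\<close>. It is built as the quotient of
  formal expressions by the congruence generated by these relations and the algebra axioms.
  (The instance is \<^class>\<open>real_algebra\<close> and \<^class>\<open>monoid_mult\<close> rather than
  \<^class>\<open>real_algebra_1\<close> since the latter would need a proof of \<open>0 \<noteq> 1\<close> for every form
  space \<open>V\<close>.)\<close>

datatype 'v cl_term = Gen 'v | Const real
  | Add "'v cl_term" "'v cl_term" | Mul "'v cl_term" "'v cl_term"

inductive cl_rel :: "'v::form_space cl_term \<Rightarrow> 'v cl_term \<Rightarrow> bool" where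
  refl: "cl_rel x x"
| sym: "cl_rel x y \<Longrightarrow> cl_rel y x"
| trans: "cl_rel x y \<Longrightarrow> cl_rel y z \<Longrightarrow> cl_rel x z"
| add_cong: "cl_rel x x' \<Longrightarrow> cl_rel y y' \<Longrightarrow> cl_rel (Add x y) (Add x' y')"
| mul_cong: "cl_rel x x' \<Longrightarrow> cl_rel y y' \<Longrightarrow> cl_rel (Mul x y) (Mul x' y')"
| add_assoc: "cl_rel (Add (Add x y) z) (Add x (Add y z))"
| add_commute: "cl_rel (Add x y) (Add y x)"
| add_zero: "cl_rel (Add (Const 0) x) x"
| add_minus: "cl_rel (Add (Mul (Const (- 1)) x) x) (Const 0)"
| mul_assoc: "cl_rel (Mul (Mul x y) z) (Mul x (Mul y z))"
| mul_one_left: "cl_rel (Mul (Const 1) x) x"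
| mul_one_right: "cl_rel (Mul x (Const 1)) x"
| distrib_right: "cl_rel (Mul (Add x y) z) (Add (Mul x z) (Mul y z))"
| distrib_left: "cl_rel (Mul x (Add y z)) (Add (Mul x y) (Mul x z))"
| const_add: "cl_rel (Const (a + b)) (Add (Const a) (Const b))"
| const_mul: "cl_rel (Const (a * b)) (Mul (Const a) (Const b))"
| const_central: "cl_rel (Mul (Const a) x) (Mul x (Const a))"
| gen_add: "cl_rel (Gen (u + v)) (Add (Gen u) (Gen v))"
| gen_scale: "cl_rel (Gen (a *\<^sub>R v)) (Mul (Const a) (Gen v))"
| clifford: "cl_rel (Mul (Gen v) (Gen v)) (Const (- sform v v))"

quotient_type (overloaded) 'v clifford = "'v::form_space cl_term" / cl_rel
  by (intro equivpI reflpI sympI transpI)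
    (rule cl_rel.refl, erule cl_rel.sym, erule (1) cl_rel.trans)

lemma clifford_abs_surj: "\<exists>t. x = abs_clifford t"
  by (metis Quotient_abs_rep Quotient_clifford)

text \<open>The canonical map \<open>V \<rightarrow> Cl(V)\<close>.\<close>

lift_definition cl_vec :: "'v::form_space \<Rightarrow> 'v clifford" is Gen .

instantiation clifford :: (form_space) "{real_algebra, monoid_mult}"
begin

lift_definition zero_clifford :: "'a clifford" is "Const 0" .
lift_definition one_clifford :: "'a clifford" is "Const 1" .
lift_definition plus_clifford :: "'a clifford \<Rightarrow> 'a clifford \<Rightarrow> 'a clifford" is Add
  by (rule cl_rel.add_cong)
lift_definition times_clifford :: "'a clifford \<Rightarrow> 'a clifford \<Rightarrow> 'a clifford" is Mul
  by (rule cl_rel.mul_cong)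
lift_definition scaleR_clifford :: "real \<Rightarrow> 'a clifford \<Rightarrow> 'a clifford" is "\<lambda>a. Mul (Const a)"
  by (rule cl_rel.mul_cong[OF cl_rel.refl])
lift_definition uminus_clifford :: "'a clifford \<Rightarrow> 'a clifford" is "Mul (Const (- 1))"
  by (rule cl_rel.mul_cong[OF cl_rel.refl])
definition minus_clifford :: "'a clifford \<Rightarrow> 'a clifford \<Rightarrow> 'a clifford" where
  "minus_clifford x y = x + (- y)"

instance
proof
  fix x y z :: "'a clifford" and a b :: real
  obtain t u v where abs: "x = abs_clifford t" "y = abs_clifford u" "z = abs_clifford v"
    by (metis clifford_abs_surj)
  note d = abs zero_clifford.abs_eq one_clifford.abs_eq plus_clifford.abs_eq
    times_clifford.abs_eq scaleR_clifford.abs_eq uminus_clifford.abs_eq clifford.abs_eq_iff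
  show "x + y + z = x + (y + z)" unfolding d by (rule cl_rel.add_assoc)
  show "x + y = y + x" unfolding d by (rule cl_rel.add_commute)
  show "0 + x = x" unfolding d by (rule cl_rel.add_zero)
  show "- x + x = 0" unfolding d by (rule cl_rel.add_minus)
  show "x - y = x + - y" by (rule minus_clifford_def)
  show "x * y * z = x * (y * z)" unfolding d by (rule cl_rel.mul_assoc)
  show "1 * x = x" unfolding d by (rule cl_rel.mul_one_left)
  show "x * 1 = x" unfolding d by (rule cl_rel.mul_one_right)
  show "(x + y) * z = x * z + y * z" unfolding d by (rule cl_rel.distrib_right)
  show "x * (y + z) = x * y + x * z" unfolding d by (rule cl_rel.distrib_left)
  show "a *\<^sub>R (x + y) = a *\<^sub>R x + a *\<^sub>R y" unfolding d by (rule cl_rel.distrib_left)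
  show "(a + b) *\<^sub>R x = a *\<^sub>R x + b *\<^sub>R x"
    unfolding d by (rule cl_rel.trans[OF cl_rel.mul_cong[OF cl_rel.const_add cl_rel.refl]
          cl_rel.distrib_right])
  show "a *\<^sub>R b *\<^sub>R x = (a * b) *\<^sub>R x"
    unfolding d by (rule cl_rel.trans[OF cl_rel.sym[OF cl_rel.mul_assoc]
          cl_rel.mul_cong[OF cl_rel.sym[OF cl_rel.const_mul] cl_rel.refl]])
  show "1 *\<^sub>R x = x" unfolding d by (rule cl_rel.mul_one_left)
  show "a *\<^sub>R x * y = a *\<^sub>R (x * y)" unfolding d by (rule cl_rel.mul_assoc)
  show "x * a *\<^sub>R y = a *\<^sub>R (x * y)"
    unfolding d by (rule cl_rel.trans[OF cl_rel.sym[OF cl_rel.mul_assoc]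
          cl_rel.trans[OF cl_rel.mul_cong[OF cl_rel.sym[OF cl_rel.const_central] cl_rel.refl]
            cl_rel.mul_assoc]])
qed

end

lemma cl_vec_add: "cl_vec (u + v) = cl_vec u + cl_vec v"
  unfolding cl_vec.abs_eq plus_clifford.abs_eq clifford.abs_eq_iff by (rule cl_rel.gen_add)

lemma cl_vec_scaleR: "cl_vec (a *\<^sub>R v) = a *\<^sub>R cl_vec v"
  unfolding cl_vec.abs_eq scaleR_clifford.abs_eq clifford.abs_eq_iff by (rule cl_rel.gen_scale)

lemma cl_vec_zero [simp]: "cl_vec 0 = 0"
  using cl_vec_scaleR[of 0 0] by simp

lemma cl_vec_minus: "cl_vec (- v) = - cl_vec v"
  using cl_vec_scaleR[of "-1" v] by simp

lemma cl_vec_square: "cl_vec v * cl_vec v = - sform v v *\<^sub>R 1"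
  unfolding cl_vec.abs_eq times_clifford.abs_eq one_clifford.abs_eq scaleR_clifford.abs_eq
    clifford.abs_eq_iff
  by (rule cl_rel.trans[OF cl_rel.clifford cl_rel.sym[OF cl_rel.mul_one_right]])

lemma clifford_induct [case_names gen const add mul]:
  fixes x :: "'v::form_space clifford"
  assumes "\<And>v. P (cl_vec v)" and "\<And>a. P (a *\<^sub>R 1)"
    and "\<And>x y. P x \<Longrightarrow> P y \<Longrightarrow> P (x + y)" and "\<And>x y. P x \<Longrightarrow> P y \<Longrightarrow> P (x * y)"
  shows "P x"
proof -
  have "P (abs_clifford t)" for t
  proof (induction t)
    case (Gen v)
    then show ?case using assms(1) by (simp add: cl_vec.abs_eq)
  next
    case (Const a)
    have "abs_clifford (Const a) = a *\<^sub>R (1 :: 'v clifford)"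
      by (simp add: one_clifford.abs_eq scaleR_clifford.abs_eq clifford.abs_eq_iff
          cl_rel.sym[OF cl_rel.mul_one_right])
    then show ?case using assms(2) by simp
  next
    case (Add x y)
    then show ?case using assms(3) by (simp add: plus_clifford.abs_eq[symmetric])
  next
    case (Mul x y)
    then show ?case using assms(4) by (simp add: times_clifford.abs_eq[symmetric])
  qed
  then show ?thesis by (metis Quotient_abs_rep Quotient_clifford)
qed


subsection \<open>Representations of Clifford algebras\<close>

definition clifford_rep :: "('v::form_space clifford \<Rightarrow> 's::real_vector \<Rightarrow> 's) \<Rightarrow> bool" where
  "clifford_rep \<sigma> \<longleftrightarrow>
     (\<forall>c. linear (\<sigma> c)) \<and> (\<forall>w. linear (\<lambda>c. \<sigma> c w)) \<and>
     \<sigma> 1 = id \<and> (\<forall>c d. \<sigma> (c * d) = \<sigma> c \<circ> \<sigma> d)"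

lemma clifford_rep_simps:
  assumes "clifford_rep \<sigma>"
  shows "\<sigma> (x + y) w = \<sigma> x w + \<sigma> y w" "\<sigma> (x - y) w = \<sigma> x w - \<sigma> y w"
    "\<sigma> (- x) w = - \<sigma> x w" "\<sigma> (a *\<^sub>R x) w = a *\<^sub>R \<sigma> x w" "\<sigma> 0 w = 0"
    "\<sigma> 1 w = w" "\<sigma> (x * y) w = \<sigma> x (\<sigma> y w)"
    "\<sigma> x (v + w) = \<sigma> x v + \<sigma> x w" "\<sigma> x (v - w) = \<sigma> x v - \<sigma> x w"
    "\<sigma> x (- w) = - \<sigma> x w" "\<sigma> x (a *\<^sub>R w) = a *\<^sub>R \<sigma> x w" "\<sigma> x 0 = 0"
proof -
  have 1: "linear (\<lambda>c. \<sigma> c w)" and 2: "linear (\<sigma> c)" and 3: "\<sigma> 1 = id"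
    and 4: "\<sigma> (c * d) = \<sigma> c \<circ> \<sigma> d" for c d w
    using assms unfolding clifford_rep_def by blast+
  show "\<sigma> (x + y) w = \<sigma> x w + \<sigma> y w" "\<sigma> (x - y) w = \<sigma> x w - \<sigma> y w"
    "\<sigma> (- x) w = - \<sigma> x w" "\<sigma> (a *\<^sub>R x) w = a *\<^sub>R \<sigma> x w" "\<sigma> 0 w = 0"
    by (rule linear_add[OF 1] linear_diff[OF 1] linear_neg[OF 1] linear_scale[OF 1]
        linear_0[OF 1])+
  show "\<sigma> 1 w = w" "\<sigma> (x * y) w = \<sigma> x (\<sigma> y w)"
    by (simp_all add: 3 4)
  show "\<sigma> x (v + w) = \<sigma> x v + \<sigma> x w" "\<sigma> x (v - w) = \<sigma> x v - \<sigma> x w"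
    "\<sigma> x (- w) = - \<sigma> x w" "\<sigma> x (a *\<^sub>R w) = a *\<^sub>R \<sigma> x w" "\<sigma> x 0 = 0"
    by (rule linear_add[OF 2] linear_diff[OF 2] linear_neg[OF 2] linear_scale[OF 2]
        linear_0[OF 2])+
qed

definition irreducible_clifford_rep :: "('v::form_space clifford \<Rightarrow> 's::real_vector \<Rightarrow> 's) \<Rightarrow> bool"
  where
  "irreducible_clifford_rep \<sigma> \<longleftrightarrow>
     clifford_rep \<sigma> \<and> (\<exists>w::'s. w \<noteq> 0) \<and>
     (\<forall>U. subspace U \<and> (\<forall>c. \<forall>w\<in>U. \<sigma> c w \<in> U) \<longrightarrow> U = {0} \<or> U = UNIV)"

definition rep_kernel :: "('v::form_space clifford \<Rightarrow> 's::real_vector \<Rightarrow> 's) \<Rightarrow> 'v clifford set" where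
  "rep_kernel \<sigma> = {c. \<sigma> c = (\<lambda>w. 0)}"

text \<open>\<open>cl_extend f\<close> extends an action \<open>f\<close> of the generators \<open>V\<close> to \<open>Cl(V)\<close>. As functions
  form no algebra type, this is defined by evaluating a representing expression; the result is the
  representation given by the universal property whenever \<open>f v \<circ> f v = -\<langle>v,v\<rangle>\<close>.\<close>

primrec cl_eval :: "('v \<Rightarrow> 's::real_vector \<Rightarrow> 's) \<Rightarrow> 'v cl_term \<Rightarrow> 's \<Rightarrow> 's" where
  "cl_eval f (Gen v) = f v"
| "cl_eval f (Const a) = (\<lambda>w. a *\<^sub>R w)"
| "cl_eval f (Add x y) = (\<lambda>w. cl_eval f x w + cl_eval f y w)"
| "cl_eval f (Mul x y) = (\<lambda>w. cl_eval f x (cl_eval f y w))"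

definition cl_extend :: "('v::form_space \<Rightarrow> 's::real_vector \<Rightarrow> 's) \<Rightarrow> 'v clifford \<Rightarrow> 's \<Rightarrow> 's" where
  "cl_extend f x = cl_eval f (rep_clifford x)"

definition clifford_action :: "('v::form_space \<Rightarrow> 's::real_vector \<Rightarrow> 's) \<Rightarrow> bool" where
  "clifford_action f \<longleftrightarrow>
     (\<forall>v. linear (f v)) \<and> (\<forall>w. linear (\<lambda>v. f v w)) \<and>
     (\<forall>v w. f v (f v w) = - sform v v *\<^sub>R w)"

lemma linear_cl_eval:
  assumes "clifford_action f"
  shows "linear (cl_eval f x)"
proof (induction x)
  case (Gen v)
  then show ?case using assms by (simp add: clifford_action_def)
next
  case (Const a)
  then show ?case by (simp add: linear_iff algebra_simps)
next
  case (Add x y)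
  then show ?case by (simp add: linear_compose_add)
next
  case (Mul x y)
  then show ?case using linear_compose[of "cl_eval f y" "cl_eval f x"] by (simp add: o_def)
qed

lemma cl_eval_cong:
  assumes f: "clifford_action f" and "cl_rel x y"
  shows "cl_eval f x = cl_eval f y"
  using assms(2)
proof (induction rule: cl_rel.induct)
  case (gen_add u v)
  then show ?case using f by (auto simp: clifford_action_def linear_iff fun_eq_iff)
next
  case (gen_scale a v)
  then show ?case using f by (auto simp: clifford_action_def linear_iff fun_eq_iff)
next
  case (clifford v)
  then show ?case using f by (auto simp: clifford_action_def fun_eq_iff)
qed (use linear_cl_eval[OF f] in \<open>auto simp: fun_eq_iff linear_iff algebra_simps\<close>)

lemma cl_extend_abs:
  assumes "clifford_action f"
  shows "cl_extend f (abs_clifford t) = cl_eval f t"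
  unfolding cl_extend_def
  by (rule cl_eval_cong[OF assms]) (metis clifford.abs_eq_iff Quotient_abs_rep Quotient_clifford)

lemma
  assumes f: "clifford_action f"
  shows clifford_rep_cl_extend: "clifford_rep (cl_extend f)"
    and cl_extend_cl_vec: "cl_extend f (cl_vec v) = f v"
proof -
  note surj = clifford_abs_surj
  have lin: "linear (cl_extend f c)" for c
    using linear_cl_eval[OF f] by (simp add: cl_extend_def)
  have add: "cl_extend f (c + d) w = cl_extend f c w + cl_extend f d w" for c d w
    using surj[of c] surj[of d] by (auto simp: plus_clifford.abs_eq cl_extend_abs[OF f])
  have scale: "cl_extend f (a *\<^sub>R c) w = a *\<^sub>R cl_extend f c w" for a c w
    using surj[of c] by (auto simp: scaleR_clifford.abs_eq cl_extend_abs[OF f])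
  have mult: "cl_extend f (c * d) = cl_extend f c \<circ> cl_extend f d" for c d
    using surj[of c] surj[of d] by (auto simp: times_clifford.abs_eq cl_extend_abs[OF f] fun_eq_iff)
  have one: "cl_extend f 1 = id"
    by (auto simp: one_clifford.abs_eq cl_extend_abs[OF f] fun_eq_iff)
  show "clifford_rep (cl_extend f)"
    unfolding clifford_rep_def using lin add scale mult one by (auto simp: linear_iff)
  show "cl_extend f (cl_vec v) = f v"
    by (simp add: cl_vec.abs_eq cl_extend_abs[OF f])
qed


subsection \<open>Algebra maps induced by isometries\<close>

definition cl_map :: "('v::form_space \<Rightarrow> 'w::form_space) \<Rightarrow> 'v clifford \<Rightarrow> 'w clifford" where
  "cl_map f x = abs_clifford (map_cl_term f (rep_clifford x))"

definition form_isometry :: "('v::form_space \<Rightarrow> 'w::form_space) \<Rightarrow> bool" where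
  "form_isometry f \<longleftrightarrow> linear f \<and> (\<forall>x y. sform (f x) (f y) = sform x y)"

lemma cl_rel_map:
  assumes f: "form_isometry f" and "cl_rel x y"
  shows "cl_rel (map_cl_term f x) (map_cl_term f y)"
  using assms(2)
proof (induction rule: cl_rel.induct)
  case (sym x y)
  show ?case by (rule cl_rel.sym[OF sym.IH])
next
  case (trans x y z)
  show ?case by (rule cl_rel.trans[OF trans.IH])
next
  case (gen_add u v)
  show ?case using f cl_rel.gen_add[of "f u" "f v"] by (simp add: form_isometry_def linear_add)
next
  case (gen_scale a v)
  show ?case using f cl_rel.gen_scale[of a "f v"] by (simp add: form_isometry_def linear_scale)
next
  case (clifford v)
  show ?case using f cl_rel.clifford[of "f v"] by (simp add: form_isometry_def)
qed (simp_all only: cl_term.map,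
    (assumption | rule cl_rel.refl cl_rel.add_assoc cl_rel.add_commute cl_rel.add_zero
      cl_rel.add_minus cl_rel.mul_assoc cl_rel.mul_one_left cl_rel.mul_one_right
      cl_rel.distrib_right cl_rel.distrib_left cl_rel.const_add cl_rel.const_mul
      cl_rel.const_central cl_rel.add_cong cl_rel.mul_cong)+)

lemma cl_map_abs:
  assumes "form_isometry f"
  shows "cl_map f (abs_clifford t) = abs_clifford (map_cl_term f t)"
  unfolding cl_map_def clifford.abs_eq_iff
  by (rule cl_rel_map[OF assms]) (metis clifford.abs_eq_iff Quotient_abs_rep Quotient_clifford)

lemma
  assumes f: "form_isometry f"
  shows cl_map_cl_vec: "cl_map f (cl_vec v) = cl_vec (f v)"
    and cl_map_add: "cl_map f (x + y) = cl_map f x + cl_map f y"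
    and cl_map_mult: "cl_map f (x * y) = cl_map f x * cl_map f y"
    and cl_map_scaleR: "cl_map f (a *\<^sub>R x) = a *\<^sub>R cl_map f x"
    and cl_map_one: "cl_map f 1 = 1"
proof -
  note surj = clifford_abs_surj
  show "cl_map f (cl_vec v) = cl_vec (f v)"
    by (simp add: cl_vec.abs_eq cl_map_abs[OF f])
  show "cl_map f (x + y) = cl_map f x + cl_map f y"
    using surj[of x] surj[of y] by (auto simp: plus_clifford.abs_eq cl_map_abs[OF f])
  show "cl_map f (x * y) = cl_map f x * cl_map f y"
    using surj[of x] surj[of y] by (auto simp: times_clifford.abs_eq cl_map_abs[OF f])
  show "cl_map f (a *\<^sub>R x) = a *\<^sub>R cl_map f x"
    using surj[of x] by (auto simp: scaleR_clifford.abs_eq cl_map_abs[OF f])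
  show "cl_map f 1 = 1"
    by (simp add: one_clifford.abs_eq cl_map_abs[OF f])
qed

definition cl_parity :: "'v::form_space clifford \<Rightarrow> 'v clifford" where
  "cl_parity = cl_map uminus"

definition cl_embed :: "'e::form_space clifford \<Rightarrow> 'e mink clifford" where
  "cl_embed = cl_map (\<lambda>e. Mink e 0 0)"


section \<open>The spin module of Minkowski space\<close>

text \<open>Elements of \<open>S = S\<^sub>- + S\<^sub>+ = S\<^sub>0\<^sub>,\<^sub>n\<^sub>-\<^sub>1 + S\<^sub>0\<^sub>,\<^sub>n\<^sub>-\<^sub>1\<close> are pairs; \<open>block A B C D\<close> is the matrix with
  first row \<open>A B\<close> and second row \<open>C D\<close>.\<close>

definition block :: "('s \<Rightarrow> 's) \<Rightarrow> ('s \<Rightarrow> 's) \<Rightarrow> ('s \<Rightarrow> 's) \<Rightarrow> ('s \<Rightarrow> 's)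
    \<Rightarrow> 's \<times> 's \<Rightarrow> 's \<times> 's::real_vector" where
  "block A B C D = (\<lambda>(u, w). (A u + B w, C u + D w))"

text \<open>\<open>spin_gen\<close> is the action of the vectors of \<open>\<mm>\<close>; \<open>rho_spin\<close> is its extension to \<open>Cl(\<mm>)\<close>,
  given on products in \<open>rho_spin_explicit\<close> below. The parameter \<open>\<sigma>\<close> is \<open>\<rho>\<^sub>0\<^sub>,\<^sub>n\<^sub>-\<^sub>1\<close>.\<close>

definition spin_gen :: "('e::form_space clifford \<Rightarrow> 's::real_vector \<Rightarrow> 's)
    \<Rightarrow> 'e mink \<Rightarrow> 's \<times> 's \<Rightarrow> 's \<times> 's" where
  "spin_gen \<sigma> x = block
     (\<lambda>w. - \<sigma> (cl_vec (e_part x)) w)            (\<lambda>w. (2 * sqrt 2 * p_coeff x) *\<^sub>R w)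
     (\<lambda>w. (- (1 / sqrt 2) * q_coeff x) *\<^sub>R w)   (\<sigma> (cl_vec (e_part x)))"

definition rho_spin :: "('e::form_space clifford \<Rightarrow> 's::real_vector \<Rightarrow> 's)
    \<Rightarrow> 'e mink clifford \<Rightarrow> 's \<times> 's \<Rightarrow> 's \<times> 's" where
  "rho_spin \<sigma> = cl_extend (spin_gen \<sigma>)"

lemma clifford_action_spin_gen:
  assumes "clifford_rep \<sigma>"
  shows "clifford_action (spin_gen \<sigma>)"
proof -
  note S = clifford_rep_simps[OF assms]
  have sq: "\<sigma> (cl_vec v) (\<sigma> (cl_vec v) w) = - sform v v *\<^sub>R w" for v w
    using S(7)[of "cl_vec v" "cl_vec v" w] by (simp add: cl_vec_square S)
  have "linear (spin_gen \<sigma> v)" for v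
    by (auto simp: linear_iff spin_gen_def block_def S algebra_simps)
  moreover have "linear (\<lambda>v. spin_gen \<sigma> v w)" for w
    by (cases w) (auto simp: linear_iff spin_gen_def block_def plus_mink_def
        scaleR_mink_def cl_vec_add cl_vec_scaleR S add_divide_distrib algebra_simps)
  moreover have "spin_gen \<sigma> v (spin_gen \<sigma> v w) = - sform v v *\<^sub>R w" for v w
    by (cases w) (simp add: spin_gen_def block_def sform_mink_def S sq algebra_simps)
  ultimately show ?thesis by (simp add: clifford_action_def)
qed

lemma clifford_rep_rho_spin: "clifford_rep \<sigma> \<Longrightarrow> clifford_rep (rho_spin \<sigma>)"
  unfolding rho_spin_def by (intro clifford_rep_cl_extend clifford_action_spin_gen)

lemma rho_spin_cl_vec: "clifford_rep \<sigma> \<Longrightarrow> rho_spin \<sigma> (cl_vec x) = spin_gen \<sigma> x"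
  unfolding rho_spin_def by (intro cl_extend_cl_vec clifford_action_spin_gen)

lemma isometry_parity: "form_isometry (uminus :: 'v::form_space \<Rightarrow> 'v)"
proof -
  have "sform (- x) (- y) = sform x y" for x y :: 'v
    using sform_scaleR_left[of "-1" x "-y"] sform_scaleR_right[of x "-1" y] by simp
  then show ?thesis by (auto simp: form_isometry_def linear_iff)
qed

lemma isometry_embed: "form_isometry (\<lambda>e::'e::form_space. Mink e 0 0)"
  by (auto simp: form_isometry_def linear_iff sform_mink_def)

text \<open>The explicit form of the spin representation in terms of
  \<open>Cl(\<mm>) \<cong> Cl\<^sub>1\<^sub>,\<^sub>1 \<otimes> Cl\<^sub>0\<^sub>,\<^sub>n\<^sub>-\<^sub>1\<close> (graded tensor product), where \<open>p \<otimes> c\<close> is \<open>p * cl_embed c\<close> etc.\<close>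

lemma rho_spin_explicit:
  assumes \<sigma>: "clifford_rep \<sigma>"
  defines "p \<equiv> cl_vec (Mink 0 1 0)" and "q \<equiv> cl_vec (Mink 0 0 1)"
  shows "rho_spin \<sigma> (cl_embed c) = block (\<sigma> (cl_parity c)) (\<lambda>w. 0) (\<lambda>w. 0) (\<sigma> c)"
    and "rho_spin \<sigma> (p * cl_embed c) =
      block (\<lambda>w. 0) (\<lambda>w. (2 * sqrt 2) *\<^sub>R \<sigma> c w) (\<lambda>w. 0) (\<lambda>w. 0)"
    and "rho_spin \<sigma> (q * cl_embed c) =
      block (\<lambda>w. 0) (\<lambda>w. 0) (\<lambda>w. - (1 / sqrt 2) *\<^sub>R \<sigma> (cl_parity c) w) (\<lambda>w. 0)"
    and "rho_spin \<sigma> (p * q * cl_embed c) =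
      block (\<lambda>w. (- 2) *\<^sub>R \<sigma> (cl_parity c) w) (\<lambda>w. 0) (\<lambda>w. 0) (\<lambda>w. 0)"
proof -
  note S = clifford_rep_simps[OF \<sigma>] cl_vec_minus
  note R = clifford_rep_simps[OF clifford_rep_rho_spin[OF \<sigma>]]
  note pm = cl_map_cl_vec[OF isometry_parity] cl_map_add[OF isometry_parity]
    cl_map_mult[OF isometry_parity] cl_map_scaleR[OF isometry_parity] cl_map_one[OF isometry_parity]
    cl_map_cl_vec[OF isometry_embed] cl_map_add[OF isometry_embed]
    cl_map_mult[OF isometry_embed] cl_map_scaleR[OF isometry_embed] cl_map_one[OF isometry_embed]
  show 1: "rho_spin \<sigma> (cl_embed c) = block (\<sigma> (cl_parity c)) (\<lambda>w. 0) (\<lambda>w. 0) (\<sigma> c)" for c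
  proof (induction c rule: clifford_induct)
    case (gen v)
    then show ?case
      by (simp add: cl_embed_def cl_parity_def pm rho_spin_cl_vec[OF \<sigma>] spin_gen_def block_def S)
  next
    case (const a)
    then show ?case
      by (auto simp: cl_embed_def cl_parity_def pm R block_def S fun_eq_iff)
  next
    case (add x y)
    then show ?case
      by (auto simp: cl_embed_def cl_parity_def pm R block_def S fun_eq_iff)
  next
    case (mul x y)
    then show ?case
      by (auto simp: cl_embed_def cl_parity_def pm R block_def S fun_eq_iff)
  qed
  note d = R(7) 1 p_def q_def rho_spin_cl_vec[OF \<sigma>] spin_gen_def block_def S fun_eq_iff
  show "rho_spin \<sigma> (p * cl_embed c) =
      block (\<lambda>w. 0) (\<lambda>w. (2 * sqrt 2) *\<^sub>R \<sigma> c w) (\<lambda>w. 0) (\<lambda>w. 0)"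
    by (auto simp: d)
  show "rho_spin \<sigma> (q * cl_embed c) =
      block (\<lambda>w. 0) (\<lambda>w. 0) (\<lambda>w. - (1 / sqrt 2) *\<^sub>R \<sigma> (cl_parity c) w) (\<lambda>w. 0)"
    by (auto simp: d)
  show "rho_spin \<sigma> (p * q * cl_embed c) =
      block (\<lambda>w. (- 2) *\<^sub>R \<sigma> (cl_parity c) w) (\<lambda>w. 0) (\<lambda>w. 0) (\<lambda>w. 0)"
    by (auto simp: d)
qed


section \<open>Cahen-Wallach algebras\<close>

text \<open>\<open>e\<^sup>\<flat> = \<langle>e,\<cdot>\<rangle>\<close> and its inverse \<open>E\<^sup>* \<rightarrow> E\<close>. On the finite-dimensional space \<open>E\<close> the dual is
  the type of bounded linear functionals.\<close>

definition flat :: "'e::neg_euclidean_space \<Rightarrow> 'e \<Rightarrow>\<^sub>L real" where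
  "flat e = Blinfun (sform e)"

definition sharp :: "('e::neg_euclidean_space \<Rightarrow>\<^sub>L real) \<Rightarrow> 'e" where
  "sharp = inv flat"

lemma flat_apply: "blinfun_apply (flat e) f = sform e f"
proof -
  have "bounded_linear (sform e)"
    by (simp add: sform_eq_minus_inner[abs_def] bounded_linear_minus bounded_linear_inner_right)
  then show ?thesis by (simp add: flat_def bounded_linear_Blinfun_apply)
qed

lemma linear_flat: "linear flat"
  by (auto simp: linear_iff flat_apply plus_blinfun.rep_eq scaleR_blinfun.rep_eq sform_add_left
      sform_scaleR_left intro!: blinfun_eqI)

lemma bij_flat: "bij (flat :: 'e::neg_euclidean_space \<Rightarrow> _)"
proof (rule bijI)
  show "inj (flat :: 'e \<Rightarrow> _)"
  proof (rule injI)
    fix x y :: 'e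
    assume "flat x = flat y"
    then have "x \<bullet> z = y \<bullet> z" for z
      using flat_apply[of x z] flat_apply[of y z] by (simp add: sform_eq_minus_inner)
    then show "x = y" by (metis vector_eq_rdot)
  qed
  have "\<xi> = flat (- (\<Sum>i\<in>Basis. blinfun_apply \<xi> i *\<^sub>R i))" for \<xi> :: "'e \<Rightarrow>\<^sub>L real"
    by (rule blinfun_euclidean_eqI) (simp add: flat_apply sform_eq_minus_inner)
  then show "surj (flat :: 'e \<Rightarrow> _)" unfolding surj_def by blast
qed

lemma sharp_flat [simp]: "sharp (flat e) = e"
  by (simp add: sharp_def bij_flat bij_is_inj)

lemma flat_sharp [simp]: "flat (sharp \<xi>) = \<xi>"
  by (simp add: sharp_def bij_flat bij_is_surj surj_f_inv_f)

lemma linear_sharp: "linear (sharp :: ('a::neg_euclidean_space \<Rightarrow>\<^sub>L real) \<Rightarrow> 'a)"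
proof (rule linearI)
  show "sharp (x + y) = sharp x + sharp y" for x y :: "'a \<Rightarrow>\<^sub>L real"
    using sharp_flat[of "sharp x + sharp y"] by (simp add: linear_add[OF linear_flat])
  show "sharp (a *\<^sub>R x) = a *\<^sub>R sharp x" for a and x :: "'a \<Rightarrow>\<^sub>L real"
    using sharp_flat[of "a *\<^sub>R sharp x"] by (simp add: linear_scale[OF linear_flat])
qed

text \<open>The endomorphism \<open>B\<close> with \<open>b(\<cdot>,\<cdot>) = -\<langle>B\<cdot>,\<cdot>\<rangle>\<close>.\<close>

definition cw_endo :: "('e::neg_euclidean_space \<Rightarrow> 'e \<Rightarrow> real) \<Rightarrow> 'e \<Rightarrow> 'e" where
  "cw_endo b = (THE B. \<forall>x y. b x y = - sform (B x) y)"

lemma cw_endo: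
  assumes "bilinear b"
  shows "b x y = - sform (cw_endo b x) y" and "linear (cw_endo b)"
proof -
  have "\<exists>!B. \<forall>x y. b x y = - sform (B x) y"
  proof (rule ex1I)
    let ?B = "\<lambda>x. \<Sum>i\<in>Basis. b x i *\<^sub>R i"
    show ex: "\<forall>x y. b x y = - sform (?B x) y"
    proof (intro allI)
      fix x y
      have lin: "linear (b x)" using assms by (simp add: bilinear_def)
      have "b x y = b x (\<Sum>i\<in>Basis. (y \<bullet> i) *\<^sub>R i)" by (simp add: euclidean_representation)
      also have "\<dots> = (\<Sum>i\<in>Basis. b x i * (i \<bullet> y))"
        by (simp add: linear_sum[OF lin] linear_scale[OF lin] inner_commute mult.commute)
      finally show "b x y = - sform (?B x) y"
        by (simp add: sform_eq_minus_inner inner_sum_left)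
    qed
    fix B assume B: "\<forall>x y. b x y = - sform (B x) y"
    show "B = ?B"
    proof
      fix x
      have "- sform (B x) y = - sform (?B x) y" for y
        using B ex by metis
      then have "B x \<bullet> y = ?B x \<bullet> y" for y
        unfolding sform_eq_minus_inner by simp
      then show "B x = ?B x" by (metis vector_eq_rdot)
    qed
  qed
  from theI'[OF this] have *: "b x y = - sform (cw_endo b x) y" for x y
    unfolding cw_endo_def by blast
  then show "b x y = - sform (cw_endo b x) y" .
  have inner: "cw_endo b x \<bullet> y = b x y" for x y
    using *[of x y] unfolding sform_eq_minus_inner by simp
  show "linear (cw_endo b)"
  proof (rule linearI)
    fix x y
    have "cw_endo b (x + y) \<bullet> z = (cw_endo b x + cw_endo b y) \<bullet> z" for z
      using assms by (simp add: inner inner_add_left bilinear_ladd)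
    then show "cw_endo b (x + y) = cw_endo b x + cw_endo b y"
      by (metis vector_eq_rdot)
  next
    fix r x
    have "cw_endo b (r *\<^sub>R x) \<bullet> z = (r *\<^sub>R cw_endo b x) \<bullet> z" for z
      using assms by (simp add: inner bilinear_lmul)
    then show "cw_endo b (r *\<^sub>R x) = r *\<^sub>R cw_endo b x"
      by (metis vector_eq_rdot)
  qed
qed

text \<open>\<open>\<gg>\<^sub>b = E\<^sup>* + (E + \<real>p + \<real>q)\<close> with the brackets \<open>[q,e] = e\<^sup>\<flat>\<close>, \<open>[e\<^sup>\<flat>,f] = b(e,f) p\<close>,
  \<open>[e\<^sup>\<flat>,q] = B e\<close>, extended bilinearly and antisymmetrically.\<close>

type_synonym 'e cw = "('e \<Rightarrow>\<^sub>L real) \<times> 'e mink"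

lemma cw_exhaust [case_names cw]:
  fixes x :: "'e cw"
  obtains \<xi> e s t where "x = (\<xi>, Mink e s t)"
  by (cases x; cases "snd x") auto

definition cw_flat :: "'e::neg_euclidean_space \<Rightarrow> 'e cw" where
  "cw_flat e = (flat e, Mink 0 0 0)"

definition cw_vec :: "'e::neg_euclidean_space \<Rightarrow> 'e cw" where
  "cw_vec e = (0, Mink e 0 0)"

definition cw_p :: "'e::neg_euclidean_space cw" where
  "cw_p = (0, Mink 0 1 0)"

definition cw_q :: "'e::neg_euclidean_space cw" where
  "cw_q = (0, Mink 0 0 1)"

fun cw_bracket :: "('e::neg_euclidean_space \<Rightarrow> 'e \<Rightarrow> real) \<Rightarrow> 'e cw \<Rightarrow> 'e cw \<Rightarrow> 'e cw" where
  "cw_bracket b (\<xi>, Mink e s t) (\<eta>, Mink f s' t') =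
     (t *\<^sub>R flat f - t' *\<^sub>R flat e,
      Mink (t' *\<^sub>R cw_endo b (sharp \<xi>) - t *\<^sub>R cw_endo b (sharp \<eta>))
           (b (sharp \<xi>) f - b (sharp \<eta>) e) 0)"

lemma cw_bracket_generators:
  assumes b: "bilinear b"
  shows "cw_bracket b cw_q (cw_vec e) = cw_flat e"
    and "cw_bracket b (cw_flat e) (cw_vec f) = b e f *\<^sub>R cw_p"
    and "cw_bracket b (cw_flat e) cw_q = cw_vec (cw_endo b e)"
    and "cw_bracket b (cw_flat e) (cw_flat f) = 0"
    and "cw_bracket b (cw_vec e) (cw_vec f) = 0"
    and "cw_bracket b cw_p x = 0"
proof -
  note z = linear_0[OF linear_flat] linear_0[OF linear_sharp] linear_0[OF cw_endo(2)[OF b]]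
    bilinear_lzero[OF b] bilinear_rzero[OF b]
  note d = cw_q_def cw_p_def cw_vec_def cw_flat_def zero_prod_def zero_mink_def
  show "cw_bracket b cw_q (cw_vec e) = cw_flat e"
    "cw_bracket b (cw_flat e) (cw_vec f) = b e f *\<^sub>R cw_p"
    "cw_bracket b (cw_flat e) cw_q = cw_vec (cw_endo b e)"
    "cw_bracket b (cw_flat e) (cw_flat f) = 0"
    "cw_bracket b (cw_vec e) (cw_vec f) = 0"
    by (simp_all add: d z)
  show "cw_bracket b cw_p x = 0"
    by (cases x rule: cw_exhaust) (simp add: d z)
qed

lemma cw_bracket_alternating: "cw_bracket b x x = 0"
  by (cases x rule: cw_exhaust) (auto simp: zero_prod_def zero_mink_def)

lemma cw_bracket_bilinear:
  assumes b: "bilinear b"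
  shows "bilinear (cw_bracket b)"
proof -
  note s = linear_add[OF linear_flat] linear_add[OF linear_sharp] linear_add[OF cw_endo(2)[OF b]]
    linear_scale[OF linear_flat] linear_scale[OF linear_sharp] linear_scale[OF cw_endo(2)[OF b]]
    bilinear_ladd[OF b] bilinear_radd[OF b] bilinear_lmul[OF b] bilinear_rmul[OF b]
  have "cw_bracket b x (y + z) = cw_bracket b x y + cw_bracket b x z"
    "cw_bracket b (y + z) x = cw_bracket b y x + cw_bracket b z x"
    "cw_bracket b x (a *\<^sub>R y) = a *\<^sub>R cw_bracket b x y"
    "cw_bracket b (a *\<^sub>R y) x = a *\<^sub>R cw_bracket b y x" for x y z a
    by (cases x rule: cw_exhaust; cases y rule: cw_exhaust; cases z rule: cw_exhaust;
        simp add: s algebra_simps)+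
  then show ?thesis by (simp add: bilinear_def linear_iff)
qed

lemma cw_bracket_jacobi:
  assumes b: "bilinear b" and sym: "\<And>x y. b x y = b y x"
  shows "cw_bracket b x (cw_bracket b y z) + cw_bracket b y (cw_bracket b z x)
    + cw_bracket b z (cw_bracket b x y) = 0"
proof -
  note B = cw_endo(2)[OF b]
  note s = linear_diff[OF linear_flat] linear_diff[OF linear_sharp] linear_diff[OF B]
    linear_scale[OF linear_flat] linear_scale[OF linear_sharp] linear_scale[OF B]
    bilinear_lsub[OF b] bilinear_rsub[OF b] bilinear_lmul[OF b] bilinear_rmul[OF b]
    linear_0[OF linear_flat] linear_0[OF linear_sharp] linear_0[OF B]
  have inner: "cw_endo b x \<bullet> y = b x y" for x y
    using cw_endo(1)[OF b, of x y] unfolding sform_eq_minus_inner by simp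
  have BB: "b x (cw_endo b y) = b y (cw_endo b x)" for x y
    using inner[of x "cw_endo b y"] inner[of y "cw_endo b x"] by (simp add: inner_commute)
  obtain \<xi> e s1 t1 where x: "x = (\<xi>, Mink e s1 t1)" by (rule cw_exhaust)
  obtain \<eta> f s2 t2 where y: "y = (\<eta>, Mink f s2 t2)" by (rule cw_exhaust)
  obtain \<zeta> g s3 t3 where z: "z = (\<zeta>, Mink g s3 t3)" by (rule cw_exhaust)
  show ?thesis
    unfolding x y z
    by (simp add: s zero_prod_def zero_mink_def sym[of g e] sym[of g f] sym[of f e]
        BB[of "sharp \<zeta>" "sharp \<xi>"] BB[of "sharp \<zeta>" "sharp \<eta>"] BB[of "sharp \<eta>" "sharp \<xi>"]
        algebra_simps)
qed


section \<open>Zero charge spin representations\<close>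

definition cw_rep :: "('e::neg_euclidean_space \<Rightarrow> 'e \<Rightarrow> real)
    \<Rightarrow> ('e cw \<Rightarrow> 'v::real_vector \<Rightarrow> 'v) \<Rightarrow> bool" where
  "cw_rep b \<rho> \<longleftrightarrow>
     (\<forall>x. linear (\<rho> x)) \<and> (\<forall>w. linear (\<lambda>x. \<rho> x w)) \<and>
     (\<forall>x y w. \<rho> (cw_bracket b x y) w = \<rho> x (\<rho> y w) - \<rho> y (\<rho> x w))"

definition spin_cw_rep :: "('e::neg_euclidean_space \<Rightarrow> 'e \<Rightarrow> real)
    \<Rightarrow> ('e clifford \<Rightarrow> 's::real_vector \<Rightarrow> 's) \<Rightarrow> ('e cw \<Rightarrow> 's \<times> 's \<Rightarrow> 's \<times> 's) \<Rightarrow> bool" where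
  "spin_cw_rep b \<sigma> \<rho> \<longleftrightarrow>
     cw_rep b \<rho> \<and>
     (\<forall>e. \<rho> (cw_flat e) =
        block (\<lambda>w. 0) (\<lambda>w. sqrt 2 *\<^sub>R \<sigma> (cl_vec (cw_endo b e)) w) (\<lambda>w. 0) (\<lambda>w. 0))"

text \<open>The matrix above is the spin action of \<open>p \<and> B e\<close>, that is of \<open>(p (Be) - (Be) p) / 4\<close>.\<close>

lemma spin_action_wedge:
  assumes "clifford_rep \<sigma>"
  defines "p \<equiv> cl_vec (Mink 0 1 0)"
  shows "rho_spin \<sigma> ((1/4) *\<^sub>R (p * cl_embed (cl_vec f) - cl_embed (cl_vec f) * p)) =
    block (\<lambda>w. 0) (\<lambda>w. sqrt 2 *\<^sub>R \<sigma> (cl_vec f) w) (\<lambda>w. 0) (\<lambda>w. 0)"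
proof -
  note S = clifford_rep_simps[OF assms(1)]
  note R = clifford_rep_simps[OF clifford_rep_rho_spin[OF assms(1)]]
  show ?thesis
    by (auto simp: fun_eq_iff R p_def cl_embed_def cl_map_cl_vec[OF isometry_embed]
        rho_spin_cl_vec[OF assms(1)] spin_gen_def block_def S scaleR_left_distrib[symmetric])
qed

text \<open>The last conjunct is \<open>\<rho>(\<mm>) \<subseteq> \<rho>\<^sub>s\<^sub>p\<^sub>i\<^sub>n(Cl(\<mm>))\<close>, which by convention is part of the notion.\<close>

definition zero_charge_spin_rep :: "('e::neg_euclidean_space \<Rightarrow> 'e \<Rightarrow> real)
    \<Rightarrow> ('e clifford \<Rightarrow> 's::real_vector \<Rightarrow> 's) \<Rightarrow> ('e cw \<Rightarrow> 's \<times> 's \<Rightarrow> 's \<times> 's) \<Rightarrow> bool" where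
  "zero_charge_spin_rep b \<sigma> \<rho> \<longleftrightarrow>
     spin_cw_rep b \<sigma> \<rho> \<and> \<rho> cw_p = (\<lambda>w. 0) \<and>
     (\<forall>x. \<rho> (0, x) \<in> range (rho_spin \<sigma>))"

definition quadratic_clifford_eq :: "('e::neg_euclidean_space \<Rightarrow> 'e \<Rightarrow> real)
    \<Rightarrow> 'e clifford \<Rightarrow> 'e clifford \<Rightarrow> bool" where
  "quadratic_clifford_eq b c1 c2 \<longleftrightarrow>
     (let D = (\<lambda>x. c1 * x - x * c2) in
       (D ^^ 2) ` range cl_vec \<subseteq> range cl_vec \<and>
       (\<forall>e. (D ^^ 2) (cl_vec e) = cl_vec (- cw_endo b e)))"

text \<open>The linear map on \<open>\<gg>\<^sub>b\<close> with the values listed in \<open>triple_rep_generators\<close> below.\<close>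

fun triple_rep :: "('e::neg_euclidean_space \<Rightarrow> 'e \<Rightarrow> real)
    \<Rightarrow> ('e clifford \<Rightarrow> 's::real_vector \<Rightarrow> 's)
    \<Rightarrow> 'e clifford \<Rightarrow> 'e clifford \<Rightarrow> 'e clifford \<Rightarrow> 'e cw \<Rightarrow> 's \<times> 's \<Rightarrow> 's \<times> 's" where
  "triple_rep b \<sigma> c1 c2 c3 (\<xi>, Mink e s t) = block
     (\<lambda>w. t *\<^sub>R \<sigma> c1 w)
     (\<lambda>w. sqrt 2 *\<^sub>R \<sigma> (cl_vec (cw_endo b (sharp \<xi>))) w
        + sqrt 2 *\<^sub>R ((\<sigma> (cl_vec e) \<circ> \<sigma> c2) w - (\<sigma> c1 \<circ> \<sigma> (cl_vec e)) w)
        + t *\<^sub>R \<sigma> c3 w)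
     (\<lambda>w. 0)
     (\<lambda>w. t *\<^sub>R \<sigma> c2 w)"

lemma triple_rep_generators:
  assumes "clifford_rep \<sigma>" and "bilinear b"
  shows "triple_rep b \<sigma> c1 c2 c3 (cw_flat e) =
      block (\<lambda>w. 0) (\<lambda>w. sqrt 2 *\<^sub>R \<sigma> (cl_vec (cw_endo b e)) w) (\<lambda>w. 0) (\<lambda>w. 0)"
    and "triple_rep b \<sigma> c1 c2 c3 cw_p = (\<lambda>w. 0)"
    and "triple_rep b \<sigma> c1 c2 c3 (cw_vec e) =
      block (\<lambda>w. 0)
        (\<lambda>w. sqrt 2 *\<^sub>R ((\<sigma> (cl_vec e) \<circ> \<sigma> c2) w - (\<sigma> c1 \<circ> \<sigma> (cl_vec e)) w)) (\<lambda>w. 0) (\<lambda>w. 0)"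
    and "triple_rep b \<sigma> c1 c2 c3 cw_q = block (\<sigma> c1) (\<sigma> c3) (\<lambda>w. 0) (\<sigma> c2)"
    and "linear (\<lambda>x. triple_rep b \<sigma> c1 c2 c3 x w)"
proof -
  note S = clifford_rep_simps[OF assms(1)]
  note B = cw_endo(2)[OF assms(2)]
  note l = linear_0[OF linear_sharp] linear_0[OF B] linear_add[OF linear_sharp] linear_add[OF B]
    linear_scale[OF linear_sharp] linear_scale[OF B]
  note d = cw_flat_def cw_p_def cw_q_def cw_vec_def
  show "triple_rep b \<sigma> c1 c2 c3 (cw_flat e) =
      block (\<lambda>w. 0) (\<lambda>w. sqrt 2 *\<^sub>R \<sigma> (cl_vec (cw_endo b e)) w) (\<lambda>w. 0) (\<lambda>w. 0)"
    "triple_rep b \<sigma> c1 c2 c3 cw_p = (\<lambda>w. 0)"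
    "triple_rep b \<sigma> c1 c2 c3 (cw_vec e) =
      block (\<lambda>w. 0)
        (\<lambda>w. sqrt 2 *\<^sub>R ((\<sigma> (cl_vec e) \<circ> \<sigma> c2) w - (\<sigma> c1 \<circ> \<sigma> (cl_vec e)) w)) (\<lambda>w. 0) (\<lambda>w. 0)"
    "triple_rep b \<sigma> c1 c2 c3 cw_q = block (\<sigma> c1) (\<sigma> c3) (\<lambda>w. 0) (\<sigma> c2)"
    by (auto simp: d l S fun_eq_iff block_def zero_prod_def)
  have "triple_rep b \<sigma> c1 c2 c3 (x + y) w = triple_rep b \<sigma> c1 c2 c3 x w + triple_rep b \<sigma> c1 c2 c3 y w"
    "triple_rep b \<sigma> c1 c2 c3 (a *\<^sub>R x) w = a *\<^sub>R triple_rep b \<sigma> c1 c2 c3 x w" for x y a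
    by (cases x rule: cw_exhaust; cases y rule: cw_exhaust; cases w;
        simp add: l S block_def cl_vec_add cl_vec_scaleR algebra_simps)+
  then show "linear (\<lambda>x. triple_rep b \<sigma> c1 c2 c3 x w)" by (simp add: linear_iff)
qed

end

theory Submission
  imports Defs
begin

text \<open>Write \<open>D x = c\<^sub>1 x - x c\<^sub>2\<close>, so that the matrix prescribed for \<open>\<rho>(e)\<close> has the single entry
  \<open>-\<surd>2 D e\<close> and \<open>\<rho>(e\<^sup>\<flat>)\<close> has the single entry \<open>\<surd>2 B e\<close>, both in the upper right corner. The commutator
  of \<open>\<rho>(q)\<close> with such a matrix applies \<open>D\<close> to its entry. Hence \<open>[e\<^sup>\<flat>,q] = B e\<close> is respected by
  construction, \<open>[q,e] = e\<^sup>\<flat>\<close> becomes \<open>D\<^sup>2 e = -B e\<close>, and all the other brackets are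
  multiples of \<open>p\<close>, which acts by zero, as do products of two such matrices; this is \<open>triple_rep_zero_charge\<close>.

  Conversely, let \<open>\<rho>\<close> have zero charge. The image of \<open>Cl(\<mm>)\<close> consists of all block matrices with
  entries from \<open>\<sigma>(Cl(E))\<close> (\<open>range_rho_spin\<close>), so \<open>\<rho>(q)\<close> has entries \<open>c\<^sub>1, c\<^sub>3, c\<^sub>4, c\<^sub>2\<close>. As \<open>B\<close> is
  surjective, \<open>[f\<^sup>\<flat>,q] = B f\<close> determines \<open>\<rho>\<close> on \<open>E\<close>. Since \<open>\<rho>(p) = 0\<close>, the image of \<open>[f\<^sup>\<flat>,e]\<close> is zero,
  and for \<open>e = B f\<close> this gives \<open>e c\<^sub>4 e = 0\<close>; as \<open>e\<close> is invertible for \<open>e \<noteq> 0\<close>, the block \<open>c\<^sub>4\<close> is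
  zero. The bracket \<open>[q,e] = e\<^sup>\<flat>\<close> yields the quadratic equation, but only
  after applying \<open>\<sigma>\<close>.

  The subtle point is that \<open>\<sigma>\<close> may have a kernel, so that \<open>c\<^sub>1\<close> and \<open>c\<^sub>2\<close> have to be changed modulo
  \<open>I = ker \<sigma>\<close> to solve the equation in \<open>Cl(E)\<close> itself. Let \<open>\<alpha>\<close> be the parity automorphism. The
  key fact is that \<open>Cl(E)\<close> is graded simple (\<open>clifford_graded_simple\<close>): a nonzero two-sided ideal
  stable under \<open>\<alpha>\<close> contains 1. Applied to \<open>I \<inter> \<alpha>(I)\<close> it says that \<open>I\<close> contains no nonzero even or odd
  element. Applied to \<open>I + \<alpha>(I)\<close> it says that, if \<open>I \<noteq> 0\<close>, every element is congruent to an even one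
  modulo \<open>I\<close> (\<open>clifford_rep_even_lift\<close>). With even \<open>c\<^sub>1\<close> and \<open>c\<^sub>2\<close> the defect
  \<open>D\<^sup>2 e + B e\<close> is odd and lies in \<open>I\<close>, so it is zero (\<open>quadratic_clifford_eq_lift\<close>).

  Graded simplicity is proved without a basis of \<open>Cl(E)\<close>. Supercommutators with vectors preserve
  the ideal and lower the filtration degree, so they kill a nonzero element \<open>y\<close> of minimal degree
  \<open>m\<close> if \<open>m > 0\<close>. But then the Euler operator \<open>\<Sum> e\<^sub>i [e\<^sub>i, \<cdot>]\<close>, which is multiplication by \<open>2m\<close> up to
  lower degree, kills \<open>y\<close> as well, so \<open>y\<close> has degree below \<open>m\<close>: a contradiction. Hence \<open>m = 0\<close> and
  \<open>y\<close> is a scalar.\<close>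

section \<open>Parity and supercommutators\<close>

lemmas cl_parity_simps =
  cl_map_cl_vec[OF isometry_parity, folded cl_parity_def]
  cl_map_add[OF isometry_parity, folded cl_parity_def]
  cl_map_mult[OF isometry_parity, folded cl_parity_def]
  cl_map_scaleR[OF isometry_parity, folded cl_parity_def]
  cl_map_one[OF isometry_parity, folded cl_parity_def]

lemma linear_cl_vec: "linear cl_vec"
  by (simp add: linear_iff cl_vec_add cl_vec_scaleR)

lemma linear_cl_parity: "linear cl_parity"
  by (simp add: linear_iff cl_parity_simps)

lemma cl_parity_cl_parity [simp]: "cl_parity (cl_parity x) = x"
  by (induction x rule: clifford_induct) (simp_all add: cl_parity_simps)

lemma cl_vec_anticommutator:
  "cl_vec u * cl_vec v + cl_vec v * cl_vec u = (- 2 * sform u v) *\<^sub>R 1"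
proof -
  have "cl_vec (u + v) * cl_vec (u + v) =
      cl_vec u * cl_vec u + cl_vec v * cl_vec v + (cl_vec u * cl_vec v + cl_vec v * cl_vec u)"
    by (simp add: cl_vec_add algebra_simps)
  then have "cl_vec u * cl_vec v + cl_vec v * cl_vec u =
      cl_vec (u + v) * cl_vec (u + v) - cl_vec u * cl_vec u - cl_vec v * cl_vec v"
    by (simp add: algebra_simps)
  also have "\<dots> = (- sform (u + v) (u + v) + sform u u + sform v v) *\<^sub>R 1"
    by (simp add: cl_vec_square scaleR_add_left scaleR_diff_left del: minus_add_distrib)
  also have "- sform (u + v) (u + v) + sform u u + sform v v = - 2 * sform u v"
    by (simp add: sform_add_left sform_add_right sform_commute[of v u])
  finally show ?thesis .
qed

text \<open>For odd \<open>x\<close> the twist by the parity turns the commutator into an anticommutator. This is, up to a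
  scalar factor, the contraction of \<open>x\<close> with \<open>v\<close>: an antiderivation that lowers degrees by one.\<close>

definition supercomm :: "'v::form_space \<Rightarrow> 'v clifford \<Rightarrow> 'v clifford" where
  "supercomm v x = cl_vec v * x - cl_parity x * cl_vec v"

lemma supercomm_scalar: "supercomm v (a *\<^sub>R 1) = 0"
  by (simp add: supercomm_def cl_parity_simps)

lemma supercomm_add: "supercomm v (x + y) = supercomm v x + supercomm v y"
  by (simp add: supercomm_def cl_parity_simps algebra_simps)

lemma linear_supercomm_vec: "linear (\<lambda>v. supercomm v x)"
  by (simp add: linear_iff supercomm_def cl_vec_add cl_vec_scaleR algebra_simps)

lemma supercomm_cl_vec_mult:
  "supercomm u (cl_vec v * x) = (- 2 * sform u v) *\<^sub>R x - cl_vec v * supercomm u x"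
proof -
  have "supercomm u (cl_vec v * x) =
      (cl_vec u * cl_vec v + cl_vec v * cl_vec u) * x - cl_vec v * supercomm u x"
    by (simp add: supercomm_def cl_parity_simps cl_vec_minus algebra_simps)
  then show ?thesis by (simp only: cl_vec_anticommutator) simp
qed


section \<open>The degree filtration and graded simplicity\<close>

inductive cl_degree_le :: "nat \<Rightarrow> 'v::form_space clifford \<Rightarrow> bool" where
  scalar: "cl_degree_le m (a *\<^sub>R 1)"
| add: "cl_degree_le m x \<Longrightarrow> cl_degree_le m y \<Longrightarrow> cl_degree_le m (x + y)"
| vec_mult: "cl_degree_le m x \<Longrightarrow> cl_degree_le (Suc m) (cl_vec v * x)"

lemma cl_degree_le_zero: "cl_degree_le m 0"
  using cl_degree_le.scalar[of m 0] by simp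

lemma cl_degree_le_scaleR: "cl_degree_le m x \<Longrightarrow> cl_degree_le m (a *\<^sub>R x)"
proof (induction rule: cl_degree_le.induct)
  case (scalar m c)
  then show ?case using cl_degree_le.scalar[of m "a * c"] by simp
next
  case (add m x y)
  then show ?case by (simp add: scaleR_add_right cl_degree_le.add)
next
  case (vec_mult m x v)
  show ?case using cl_degree_le.vec_mult[OF vec_mult(1), of "a *\<^sub>R v"] by (simp add: cl_vec_scaleR)
qed

lemma cl_degree_le_diff: "cl_degree_le m x \<Longrightarrow> cl_degree_le m y \<Longrightarrow> cl_degree_le m (x - y)"
  using cl_degree_le.add[OF _ cl_degree_le_scaleR[of m y "-1"]] by simp

lemma cl_degree_le_mono: "cl_degree_le m x \<Longrightarrow> m \<le> n \<Longrightarrow> cl_degree_le n x"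
proof (induction arbitrary: n rule: cl_degree_le.induct)
  case (vec_mult m x v)
  then show ?case by (cases n) (auto intro: cl_degree_le.vec_mult)
qed (auto intro: cl_degree_le.intros)

lemma cl_degree_le_0D: "cl_degree_le 0 x \<Longrightarrow> \<exists>a. x = a *\<^sub>R 1"
  by (induction "0::nat" x rule: cl_degree_le.induct) (auto, metis scaleR_add_left)

lemma cl_degree_le_mult: "cl_degree_le m x \<Longrightarrow> cl_degree_le n y \<Longrightarrow> cl_degree_le (m + n) (x * y)"
proof (induction rule: cl_degree_le.induct)
  case (scalar m a)
  then show ?case by (simp add: cl_degree_le_scaleR cl_degree_le_mono[of n])
next
  case (add m x x')
  then show ?case by (simp add: ring_distribs cl_degree_le.add)
next
  case (vec_mult m x v)
  then show ?case by (simp add: mult.assoc cl_degree_le.vec_mult)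
qed

lemma cl_degree_le_exhaustive: "\<exists>m. cl_degree_le m x"
proof (induction x rule: clifford_induct)
  case (gen v)
  show ?case using cl_degree_le.vec_mult[OF cl_degree_le.scalar[of 0 1], of v] by auto
next
  case (const a)
  show ?case using cl_degree_le.scalar by blast
next
  case (add x y)
  then obtain m n where "cl_degree_le m x" "cl_degree_le n y" by blast
  then have "cl_degree_le (max m n) (x + y)"
    by (intro cl_degree_le.add) (auto elim: cl_degree_le_mono)
  then show ?case ..
next
  case (mul x y)
  then show ?case using cl_degree_le_mult by blast
qed

text \<open>The truncated subtraction is harmless: an element of degree 0 is a scalar, and its
  supercommutators vanish.\<close>

lemma supercomm_degree: "cl_degree_le m x \<Longrightarrow> cl_degree_le (m - 1) (supercomm u x)"
proof (induction rule: cl_degree_le.induct)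
  case (vec_mult m x v)
  have "cl_degree_le m (cl_vec v * supercomm u x)"
  proof (cases m)
    case 0
    then show ?thesis
      using cl_degree_le_0D[of x] vec_mult(1) by (auto simp: supercomm_scalar cl_degree_le_zero)
  next
    case (Suc k)
    then show ?thesis using vec_mult(2) by (simp add: cl_degree_le.vec_mult)
  qed
  then show ?case
    using vec_mult(1)
    by (simp only: supercomm_cl_vec_mult diff_Suc_1 cl_degree_le_diff cl_degree_le_scaleR)
qed (simp_all add: supercomm_scalar supercomm_add cl_degree_le_zero cl_degree_le.add)

text \<open>Under the linear isomorphism with the exterior algebra this is twice the operator
  \<open>\<Sum> e\<^sub>i \<and> \<iota>(e\<^sub>i)\<close> up to terms of lower degree, and that operator multiplies each exterior power by
  its degree.\<close>

definition euler_op :: "'e::neg_euclidean_space clifford \<Rightarrow> 'e clifford" where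
  "euler_op x = (\<Sum>i\<in>Basis. cl_vec i * supercomm i x)"

lemma euler_op_scalar: "euler_op (a *\<^sub>R 1) = 0"
  by (simp add: euler_op_def supercomm_scalar)

lemma euler_op_add: "euler_op (x + y) = euler_op x + euler_op y"
  by (simp add: euler_op_def supercomm_add ring_distribs sum.distrib)

lemma euler_op_cl_vec_mult:
  fixes v :: "'e::neg_euclidean_space"
  shows "euler_op (cl_vec v * x) =
    2 *\<^sub>R (cl_vec v * x) + cl_vec v * euler_op x - 2 *\<^sub>R supercomm v x"
proof -
  have vec: "(\<Sum>i\<in>Basis. (v \<bullet> i) *\<^sub>R cl_vec i) = cl_vec v"
    using linear_sum[OF linear_cl_vec, of "\<lambda>i. (v \<bullet> i) *\<^sub>R i" Basis]
    by (simp add: cl_vec_scaleR euclidean_representation)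
  have comm: "(\<Sum>i\<in>Basis. (v \<bullet> i) *\<^sub>R supercomm i x) = supercomm v x"
    using linear_sum[OF linear_supercomm_vec[of x], of "\<lambda>i. (v \<bullet> i) *\<^sub>R i" Basis]
    by (simp add: linear_scale[OF linear_supercomm_vec] euclidean_representation)
  have "cl_vec i * supercomm i (cl_vec v * x) =
      2 *\<^sub>R ((v \<bullet> i) *\<^sub>R cl_vec i * x) + cl_vec v * (cl_vec i * supercomm i x)
      - 2 *\<^sub>R ((v \<bullet> i) *\<^sub>R supercomm i x)" for i
  proof -
    have "cl_vec i * cl_vec v = (2 * (v \<bullet> i)) *\<^sub>R 1 - cl_vec v * cl_vec i"
      using cl_vec_anticommutator[of i v]
      by (simp add: sform_eq_minus_inner inner_commute algebra_simps)
    then have "cl_vec i * (cl_vec v * y) = (2 * (v \<bullet> i)) *\<^sub>R y - cl_vec v * (cl_vec i * y)" for y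
      by (simp only: mult.assoc[symmetric]) (simp add: left_diff_distrib)
    then show ?thesis
      by (simp add: supercomm_cl_vec_mult sform_eq_minus_inner inner_commute algebra_simps)
  qed
  then have "euler_op (cl_vec v * x) = 2 *\<^sub>R ((\<Sum>i\<in>Basis. (v \<bullet> i) *\<^sub>R cl_vec i) * x)
      + cl_vec v * euler_op x - 2 *\<^sub>R (\<Sum>i\<in>Basis. (v \<bullet> i) *\<^sub>R supercomm i x)"
    unfolding euler_op_def
    by (simp only: sum_subtractf sum.distrib sum_distrib_left sum_distrib_right scaleR_sum_right)
  then show ?thesis by (simp only: vec comm)
qed

text \<open>By the product rule above, multiplication by a vector raises the eigenvalue by 2, and the
  correction term \<open>2 supercomm v x\<close> has lower degree. In particular an element of degree at most \<open>m > 0\<close>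
  all of whose supercommutators vanish has degree at most \<open>m - 1\<close>.\<close>

lemma euler_op_degree:
  "cl_degree_le m x \<Longrightarrow> cl_degree_le (m - 1) (euler_op x - (2 * real m) *\<^sub>R x)"
proof (induction rule: cl_degree_le.induct)
  case (scalar m a)
  show ?case
    unfolding euler_op_scalar
    by (intro cl_degree_le_diff cl_degree_le_scaleR cl_degree_le_zero cl_degree_le.scalar)
next
  case (add m x y)
  have "euler_op (x + y) - (2 * real m) *\<^sub>R (x + y) =
      (euler_op x - (2 * real m) *\<^sub>R x) + (euler_op y - (2 * real m) *\<^sub>R y)"
    by (simp add: euler_op_add algebra_simps)
  then show ?case by (simp only: cl_degree_le.add[OF add.IH])
next
  case (vec_mult m x v)
  have "euler_op (cl_vec v * x) - (2 * real (Suc m)) *\<^sub>R (cl_vec v * x) =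
      cl_vec v * (euler_op x - (2 * real m) *\<^sub>R x) - 2 *\<^sub>R supercomm v x"
    by (simp add: euler_op_cl_vec_mult algebra_simps)
  moreover have "cl_degree_le m (cl_vec v * (euler_op x - (2 * real m) *\<^sub>R x))"
  proof (cases m)
    case 0
    then show ?thesis
      using cl_degree_le_0D[of x] vec_mult(1) by (auto simp: euler_op_scalar cl_degree_le_zero)
  next
    case (Suc k)
    then show ?thesis
      using cl_degree_le.vec_mult[OF vec_mult.IH, of v] by simp
  qed
  moreover have "cl_degree_le m (supercomm v x)"
    using supercomm_degree[OF vec_mult(1)] by (rule cl_degree_le_mono) simp
  ultimately show ?case
    by (simp only: diff_Suc_1 cl_degree_le_diff cl_degree_le_scaleR)
qed

text \<open>Without the stability under parity this fails, for instance for \<open>dim E = 1\<close>, where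
  \<open>Cl(E) \<cong> \<real> \<oplus> \<real>\<close>. Parity is what keeps the supercommutators inside \<open>J\<close>; these force a nonzero
  element of minimal degree to be a scalar.\<close>

lemma clifford_graded_simple:
  fixes J :: "'e::neg_euclidean_space clifford set"
  assumes sub: "subspace J" and left: "\<And>c x. x \<in> J \<Longrightarrow> c * x \<in> J"
    and right: "\<And>c x. x \<in> J \<Longrightarrow> x * c \<in> J" and parity: "\<And>x. x \<in> J \<Longrightarrow> cl_parity x \<in> J"
    and "x \<in> J" "x \<noteq> 0"
  shows "1 \<in> J"
proof -
  let ?P = "\<lambda>m. \<exists>x\<in>J. x \<noteq> 0 \<and> cl_degree_le m x"
  define m where "m = (LEAST m. ?P m)"
  have "\<exists>m. ?P m" using assms(5,6) cl_degree_le_exhaustive by blast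
  then have "?P m" unfolding m_def by (rule LeastI_ex)
  then obtain y where y: "y \<in> J" "y \<noteq> 0" "cl_degree_le m y" by blast
  have minimal: "z = 0" if "z \<in> J" "cl_degree_le k z" "k < m" for z k
    using not_less_Least[of k ?P] that unfolding m_def by blast
  have "m = 0"
  proof (rule ccontr)
    assume m: "m \<noteq> 0"
    have "supercomm v y \<in> J" for v
      unfolding supercomm_def by (intro subspace_diff[OF sub] left right parity y(1))
    then have "supercomm v y = 0" for v
      using minimal supercomm_degree[OF y(3)] m by (meson diff_less neq0_conv zero_less_one)
    then have "euler_op y = 0" by (simp add: euler_op_def)
    then have "cl_degree_le (m - 1) ((- inverse (2 * real m)) *\<^sub>R (0 - (2 * real m) *\<^sub>R y))"
      using euler_op_degree[OF y(3)] by (metis cl_degree_le_scaleR)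
    also have "(- inverse (2 * real m)) *\<^sub>R (0 - (2 * real m) *\<^sub>R y) = y"
      using m by simp
    finally have "y = 0" using minimal[OF y(1)] m by simp
    then show False using y(2) by simp
  qed
  then obtain a where a: "y = a *\<^sub>R 1" using cl_degree_le_0D y(3) by blast
  then have "inverse a *\<^sub>R y = 1" using y(2) by auto
  then show ?thesis using subspace_scale[OF sub y(1)] by metis
qed


section \<open>Kernels of Clifford representations\<close>

text \<open>The kernel and its parity image meet in a graded ideal, and 1 acts nontrivially. So the kernel
  contains no nonzero element that is even or odd.\<close>

lemma rep_kernel_Int_parity_kernel:
  fixes \<sigma> :: "'e::neg_euclidean_space clifford \<Rightarrow> 's::real_vector \<Rightarrow> 's"
  assumes \<sigma>: "clifford_rep \<sigma>" and "(w0::'s) \<noteq> 0"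
    and "x \<in> rep_kernel \<sigma>" and "cl_parity x \<in> rep_kernel \<sigma>"
  shows "x = 0"
proof (rule ccontr)
  note S = clifford_rep_simps[OF \<sigma>]
  let ?J = "{x. x \<in> rep_kernel \<sigma> \<and> cl_parity x \<in> rep_kernel \<sigma>}"
  assume "x \<noteq> 0"
  have "1 \<in> ?J"
  proof (rule clifford_graded_simple[of ?J x])
    show "subspace ?J"
      by (auto simp: subspace_def rep_kernel_def fun_eq_iff S cl_parity_simps
          linear_0[OF linear_cl_parity])
  qed (use assms \<open>x \<noteq> 0\<close> in \<open>auto simp: rep_kernel_def fun_eq_iff S cl_parity_simps\<close>)
  then show False using assms(2) by (auto simp: rep_kernel_def fun_eq_iff S)
qed

text \<open>The sum of a nonzero kernel \<open>I\<close> and its parity image is a graded ideal, so it is the whole algebra.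
  Writing \<open>c = x + \<alpha>(z)\<close> with \<open>x, z \<in> I\<close>, the even element \<open>z + \<alpha>(z)\<close> differs from \<open>c\<close> by \<open>z - x \<in> I\<close>.\<close>

lemma clifford_rep_even_lift:
  fixes \<sigma> :: "'e::neg_euclidean_space clifford \<Rightarrow> 's::real_vector \<Rightarrow> 's"
  assumes \<sigma>: "clifford_rep \<sigma>" and "x \<in> rep_kernel \<sigma>" and "x \<noteq> 0"
  shows "\<exists>d. cl_parity d = d \<and> \<sigma> d = \<sigma> c"
proof -
  note S = clifford_rep_simps[OF \<sigma>]
  let ?J = "{y + cl_parity z | y z. y \<in> rep_kernel \<sigma> \<and> z \<in> rep_kernel \<sigma>}"
  have ker: "0 \<in> rep_kernel \<sigma>" by (simp add: rep_kernel_def fun_eq_iff S)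
  have "1 \<in> ?J"
  proof (rule clifford_graded_simple[of ?J x])
    have kersub: "subspace (rep_kernel \<sigma>)"
      by (auto simp: subspace_def rep_kernel_def fun_eq_iff S)
    have "?J = {y + z | y z. y \<in> rep_kernel \<sigma> \<and> z \<in> cl_parity ` rep_kernel \<sigma>}" by blast
    then show "subspace ?J"
      using subspace_sums[OF kersub linear_subspace_image[OF linear_cl_parity kersub]] by simp
  next
    fix c u assume "u \<in> ?J"
    then obtain y z where u: "u = y + cl_parity z" "y \<in> rep_kernel \<sigma>" "z \<in> rep_kernel \<sigma>" by blast
    have "c * u = c * y + cl_parity (cl_parity c * z)" "u * c = y * c + cl_parity (z * cl_parity c)"
      "cl_parity u = z + cl_parity y"
      by (simp_all add: u(1) cl_parity_simps algebra_simps)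
    moreover have "c * y \<in> rep_kernel \<sigma>" "cl_parity c * z \<in> rep_kernel \<sigma>"
      "y * c \<in> rep_kernel \<sigma>" "z * cl_parity c \<in> rep_kernel \<sigma>"
      using u by (auto simp: rep_kernel_def fun_eq_iff S)
    ultimately show "c * u \<in> ?J" "u * c \<in> ?J" "cl_parity u \<in> ?J" using u(2,3) by blast+
  next
    have "x = x + cl_parity 0" by (simp add: linear_0[OF linear_cl_parity])
    then show "x \<in> ?J" using assms(2) ker by blast
  qed (rule assms(3))
  then obtain y z where yz: "1 = y + cl_parity z" "y \<in> rep_kernel \<sigma>" "z \<in> rep_kernel \<sigma>" by blast
  let ?z = "cl_parity c * z"
  have c: "c = c * y + cl_parity ?z"
    using arg_cong[OF yz(1), of "\<lambda>x. c * x"] by (simp add: cl_parity_simps ring_distribs)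
  have "\<sigma> (?z + cl_parity ?z) w = \<sigma> c w" for w
  proof -
    have "\<sigma> c w = \<sigma> (c * y + cl_parity ?z) w" using arg_cong[OF c, of "\<lambda>x. \<sigma> x w"] .
    then show ?thesis using yz(2,3) by (simp add: rep_kernel_def fun_eq_iff S)
  qed
  moreover have "cl_parity (?z + cl_parity ?z) = ?z + cl_parity ?z"
    by (simp add: cl_parity_simps)
  ultimately show ?thesis by blast
qed

lemma quadratic_clifford_eq_iff:
  "quadratic_clifford_eq b c1 c2 \<longleftrightarrow>
    (\<forall>e. c1 * (c1 * cl_vec e - cl_vec e * c2) - (c1 * cl_vec e - cl_vec e * c2) * c2
      = - cl_vec (cw_endo b e))"
  by (auto simp: quadratic_clifford_eq_def Let_def numeral_2_eq_2 cl_vec_minus[symmetric])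

text \<open>A solution modulo the kernel lifts to a solution with the same image. If the kernel is nonzero,
  take even representatives: their defect is odd and lies in the kernel, so it vanishes.\<close>

lemma quadratic_clifford_eq_lift:
  fixes \<sigma> :: "'e::neg_euclidean_space clifford \<Rightarrow> 's::real_vector \<Rightarrow> 's"
  assumes \<sigma>: "clifford_rep \<sigma>" and w0: "(w0::'s) \<noteq> 0"
    and eq: "\<And>e. \<sigma> (c1 * (c1 * cl_vec e - cl_vec e * c2) - (c1 * cl_vec e - cl_vec e * c2) * c2)
      = \<sigma> (- cl_vec (cw_endo b e))"
  shows "\<exists>d1 d2. quadratic_clifford_eq b d1 d2 \<and> \<sigma> d1 = \<sigma> c1 \<and> \<sigma> d2 = \<sigma> c2"
proof (cases "rep_kernel \<sigma> \<subseteq> {0}")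
  case True
  note S = clifford_rep_simps[OF \<sigma>]
  have "x = y" if "\<sigma> x = \<sigma> y" for x y
  proof -
    have "x - y \<in> rep_kernel \<sigma>" using that by (simp add: rep_kernel_def fun_eq_iff S)
    then show ?thesis using True by auto
  qed
  then show ?thesis using eq unfolding quadratic_clifford_eq_iff by blast
next
  case False
  note S = clifford_rep_simps[OF \<sigma>]
  obtain x where x: "x \<in> rep_kernel \<sigma>" "x \<noteq> 0" using False by blast
  obtain d1 d2 where d: "cl_parity d1 = d1" "\<sigma> d1 = \<sigma> c1" "cl_parity d2 = d2" "\<sigma> d2 = \<sigma> c2"
    using clifford_rep_even_lift[OF \<sigma> x] by metis
  have "d1 * (d1 * cl_vec e - cl_vec e * d2) - (d1 * cl_vec e - cl_vec e * d2) * d2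
      = - cl_vec (cw_endo b e)" for e
  proof -
    let ?x = "d1 * (d1 * cl_vec e - cl_vec e * d2) - (d1 * cl_vec e - cl_vec e * d2) * d2
      + cl_vec (cw_endo b e)"
    have ker: "?x \<in> rep_kernel \<sigma>"
      using eq[of e] by (simp add: rep_kernel_def fun_eq_iff S d)
    have odd: "cl_parity ?x = - ?x"
      by (simp add: cl_parity_simps linear_diff[OF linear_cl_parity] d cl_vec_minus algebra_simps)
    have "cl_parity ?x \<in> rep_kernel \<sigma>"
      unfolding odd using ker by (simp only: rep_kernel_def mem_Collect_eq fun_eq_iff S(3)) simp
    from rep_kernel_Int_parity_kernel[OF \<sigma> w0 ker this]
    show ?thesis by (simp add: add_eq_0_iff)
  qed
  then show ?thesis unfolding quadratic_clifford_eq_iff using d by blast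
qed


section \<open>Representations of the Cahen-Wallach algebra\<close>

text \<open>The generators have entries in \<open>\<sigma>(Cl(E))\<close>, and such block matrices form an algebra. Conversely
  the elements \<open>c\<close>, \<open>p c\<close>, \<open>q c\<close> and \<open>p q c\<close> reach each of the four entries separately.\<close>

lemma range_rho_spin:
  fixes \<sigma> :: "'e::form_space clifford \<Rightarrow> 's::real_vector \<Rightarrow> 's"
  assumes \<sigma>: "clifford_rep \<sigma>"
  shows "M \<in> range (rho_spin \<sigma>) \<longleftrightarrow> (\<exists>a b c d. M = block (\<sigma> a) (\<sigma> b) (\<sigma> c) (\<sigma> d))"
proof
  note S = clifford_rep_simps[OF \<sigma>]
  note R = clifford_rep_simps[OF clifford_rep_rho_spin[OF \<sigma>]]
  show "\<exists>a b c d. M = block (\<sigma> a) (\<sigma> b) (\<sigma> c) (\<sigma> d)" if "M \<in> range (rho_spin \<sigma>)"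
  proof -
    obtain x where M: "M = rho_spin \<sigma> x" using \<open>M \<in> range (rho_spin \<sigma>)\<close> by blast
    show ?thesis unfolding M
    proof (induction x rule: clifford_induct)
      case (gen v)
      have "rho_spin \<sigma> (cl_vec v) = block (\<sigma> (- cl_vec (e_part v)))
        (\<sigma> ((2 * sqrt 2 * p_coeff v) *\<^sub>R 1)) (\<sigma> ((- (1 / sqrt 2) * q_coeff v) *\<^sub>R 1))
        (\<sigma> (cl_vec (e_part v)))"
        by (simp add: rho_spin_cl_vec[OF \<sigma>] spin_gen_def block_def S fun_eq_iff)
      then show ?case by blast
    next
      case (const a)
      have "rho_spin \<sigma> (a *\<^sub>R 1) = block (\<sigma> (a *\<^sub>R 1)) (\<sigma> 0) (\<sigma> 0) (\<sigma> (a *\<^sub>R 1))"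
        by (simp add: R block_def S fun_eq_iff)
      then show ?case by blast
    next
      case (add x y)
      then obtain a b c d a' b' c' d' where
        "rho_spin \<sigma> x = block (\<sigma> a) (\<sigma> b) (\<sigma> c) (\<sigma> d)"
        "rho_spin \<sigma> y = block (\<sigma> a') (\<sigma> b') (\<sigma> c') (\<sigma> d')" by blast
      then have "rho_spin \<sigma> (x + y) =
          block (\<sigma> (a + a')) (\<sigma> (b + b')) (\<sigma> (c + c')) (\<sigma> (d + d'))"
        by (simp add: R block_def S fun_eq_iff)
      then show ?case by blast
    next
      case (mul x y)
      then obtain a b c d a' b' c' d' where
        "rho_spin \<sigma> x = block (\<sigma> a) (\<sigma> b) (\<sigma> c) (\<sigma> d)"
        "rho_spin \<sigma> y = block (\<sigma> a') (\<sigma> b') (\<sigma> c') (\<sigma> d')" by blast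
      then have "rho_spin \<sigma> (x * y) = block (\<sigma> (a * a' + b * c')) (\<sigma> (a * b' + b * d'))
          (\<sigma> (c * a' + d * c')) (\<sigma> (c * b' + d * d'))"
        by (simp add: R block_def S fun_eq_iff)
      then show ?case by blast
    qed
  qed
  assume "\<exists>a b c d. M = block (\<sigma> a) (\<sigma> b) (\<sigma> c) (\<sigma> d)"
  then obtain a b c d where M: "M = block (\<sigma> a) (\<sigma> b) (\<sigma> c) (\<sigma> d)" by blast
  let ?p = "cl_vec (Mink 0 1 0) :: 'e mink clifford"
  let ?q = "cl_vec (Mink 0 0 1) :: 'e mink clifford"
  (* cl_embed d contributes d to the lower right and parity d to the upper left entry;
     the second summand corrects the latter. *)
  have "M = rho_spin \<sigma> (cl_embed d
      + ?p * ?q * cl_embed ((- 1 / 2) *\<^sub>R (cl_parity a - d))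
      + ?p * cl_embed ((1 / (2 * sqrt 2)) *\<^sub>R b)
      + ?q * cl_embed ((- sqrt 2) *\<^sub>R cl_parity c))"
    unfolding M
    by (simp only: fun_eq_iff R rho_spin_explicit[OF \<sigma>])
      (auto simp: block_def S cl_parity_simps linear_diff[OF linear_cl_parity]
        linear_neg[OF linear_cl_parity] algebra_simps)
  then show "M \<in> range (rho_spin \<sigma>)" by blast
qed

text \<open>The upper right entry of the commutator of the matrices of \<open>x\<close> and \<open>y\<close> is \<open>t D Y - t' D X\<close>,
  where \<open>X, Y\<close> are their upper right entries and \<open>t, t'\<close> the coefficients of \<open>q\<close>. The equation
  \<open>D\<^sup>2 e = -B e\<close> identifies it with the entry of the bracket.\<close>

lemma triple_rep_zero_charge:
  fixes \<sigma> :: "'e::neg_euclidean_space clifford \<Rightarrow> 's::real_vector \<Rightarrow> 's"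
  assumes \<sigma>: "clifford_rep \<sigma>" and b: "bilinear b" and eq: "quadratic_clifford_eq b c1 c2"
  shows "zero_charge_spin_rep b \<sigma> (triple_rep b \<sigma> c1 c2 c3)"
proof -
  note S = clifford_rep_simps[OF \<sigma>]
  note T = triple_rep_generators[OF \<sigma> b]
  note B = cw_endo(2)[OF b]
  let ?B = "cw_endo b"
  define D where "D x = c1 * x - x * c2" for x
  have D: "linear D" by (simp add: D_def linear_iff algebra_simps)
  have DD: "D (D (cl_vec e)) = - cl_vec (?B e)" for e
    using eq unfolding quadratic_clifford_eq_iff D_def by blast
  (* The upper right entry as an element of Cl(E): the bracket relations then reduce to
     linearity of D and the quadratic equation. *)
  define U where "U \<xi> e t = sqrt 2 *\<^sub>R cl_vec (?B (sharp \<xi>)) - sqrt 2 *\<^sub>R D (cl_vec e) + t *\<^sub>R c3"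
    for \<xi> :: "'e \<Rightarrow>\<^sub>L real" and e t
  have blk: "triple_rep b \<sigma> c1 c2 c3 (\<xi>, Mink e s t) =
      block (\<sigma> (t *\<^sub>R c1)) (\<sigma> (U \<xi> e t)) (\<sigma> 0) (\<sigma> (t *\<^sub>R c2))" for \<xi> e s t
    by (simp add: block_def fun_eq_iff U_def D_def S algebra_simps)
  have bracket: "triple_rep b \<sigma> c1 c2 c3 (cw_bracket b x y) w =
      triple_rep b \<sigma> c1 c2 c3 x (triple_rep b \<sigma> c1 c2 c3 y w)
      - triple_rep b \<sigma> c1 c2 c3 y (triple_rep b \<sigma> c1 c2 c3 x w)" for x y w
  proof -
    obtain \<xi> e s t where x: "x = (\<xi>, Mink e s t)" by (rule cw_exhaust)
    obtain \<eta> f s' t' where y: "y = (\<eta>, Mink f s' t')" by (rule cw_exhaust)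
    have "U (t *\<^sub>R flat f - t' *\<^sub>R flat e) (t' *\<^sub>R ?B (sharp \<xi>) - t *\<^sub>R ?B (sharp \<eta>)) 0
        = t *\<^sub>R D (U \<eta> f t') - t' *\<^sub>R D (U \<xi> e t)"
      by (simp add: U_def linear_add[OF D] linear_diff[OF D] linear_scale[OF D] DD
          linear_diff[OF linear_sharp] linear_scale[OF linear_sharp] linear_diff[OF B]
          linear_scale[OF B] linear_diff[OF linear_cl_vec] cl_vec_scaleR algebra_simps)
    then have u: "\<sigma> (U (t *\<^sub>R flat f - t' *\<^sub>R flat e) (t' *\<^sub>R ?B (sharp \<xi>) - t *\<^sub>R ?B (sharp \<eta>)) 0) w
        = t *\<^sub>R (\<sigma> c1 (\<sigma> (U \<eta> f t') w) - \<sigma> (U \<eta> f t') (\<sigma> c2 w))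
          - t' *\<^sub>R (\<sigma> c1 (\<sigma> (U \<xi> e t) w) - \<sigma> (U \<xi> e t) (\<sigma> c2 w))" for w
      by (simp add: D_def S)
    show ?thesis
      unfolding x y cw_bracket.simps blk
      by (cases w) (simp add: block_def u S algebra_simps)
  qed
  have "linear (triple_rep b \<sigma> c1 c2 c3 x)" for x
    by (cases x rule: cw_exhaust)
      (simp only: blk, auto simp: linear_iff block_def S algebra_simps)
  then have "cw_rep b (triple_rep b \<sigma> c1 c2 c3)"
    unfolding cw_rep_def using T(5) bracket by blast
  moreover have "triple_rep b \<sigma> c1 c2 c3 (0, x) \<in> range (rho_spin \<sigma>)" for x
    unfolding range_rho_spin[OF \<sigma>] using blk by (cases x) blast
  ultimately show ?thesis
    unfolding zero_charge_spin_rep_def spin_cw_rep_def using T by blast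
qed

lemma cw_decompose:
  "(\<xi>, Mink e s t) = cw_flat (sharp \<xi>) + cw_vec e + s *\<^sub>R cw_p + t *\<^sub>R cw_q"
  by (simp add: cw_flat_def cw_vec_def cw_p_def cw_q_def)

text \<open>Only \<open>\<rho>(q)\<close> is free: as \<open>B\<close> is surjective, the bracket with \<open>e\<^sup>\<flat>\<close> determines \<open>\<rho>\<close> on \<open>E\<close>. The
  remaining brackets force the lower left entry of \<open>\<rho>(q)\<close> to vanish and the diagonal entries to
  solve the quadratic equation modulo the kernel of \<open>\<sigma>\<close>.\<close>

lemma zero_charge_is_triple_rep:
  fixes \<sigma> :: "'e::neg_euclidean_space clifford \<Rightarrow> 's::real_vector \<Rightarrow> 's"
  assumes \<sigma>: "clifford_rep \<sigma>" and w0: "(w0::'s) \<noteq> 0" and b: "bilinear b"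
    and nondeg: "\<forall>x. (\<forall>y. b x y = 0) \<longrightarrow> x = 0"
    and \<rho>: "zero_charge_spin_rep b \<sigma> \<rho>"
  shows "\<exists>c1 c2 c3. quadratic_clifford_eq b c1 c2 \<and> \<rho> = triple_rep b \<sigma> c1 c2 c3"
proof -
  note S = clifford_rep_simps[OF \<sigma>]
  note G = cw_bracket_generators[OF b]
  note B = cw_endo(2)[OF b]
  let ?B = "cw_endo b"
  have "inj ?B"
    unfolding linear_injective_0[OF B] using cw_endo(1)[OF b] nondeg
    by (metis sform_commute sform_scaleR_left add_0 sform_eq_minus_inner inner_zero_left minus_zero)
  then have surj: "surj ?B" by (rule linear_inj_imp_surj[OF B])
  have lin: "linear (\<lambda>x. \<rho> x w)" and br: "\<rho> (cw_bracket b x y) w = \<rho> x (\<rho> y w) - \<rho> y (\<rho> x w)"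
    and flat: "\<rho> (cw_flat e) =
      block (\<lambda>w. 0) (\<lambda>w. sqrt 2 *\<^sub>R \<sigma> (cl_vec (?B e)) w) (\<lambda>w. 0) (\<lambda>w. 0)"
    and p: "\<rho> cw_p = (\<lambda>w. 0)" and spin: "\<rho> (0, z) \<in> range (rho_spin \<sigma>)" for x y z w e
    using \<rho> unfolding zero_charge_spin_rep_def spin_cw_rep_def cw_rep_def by blast+
  obtain a1 c3 c4 a2 where q: "\<rho> cw_q = block (\<sigma> a1) (\<sigma> c3) (\<sigma> c4) (\<sigma> a2)"
    using spin[of "Mink 0 0 1"] unfolding range_rho_spin[OF \<sigma>] cw_q_def by blast
  have vec: "\<rho> (cw_vec e) = block (\<lambda>w. sqrt 2 *\<^sub>R \<sigma> (cl_vec e) (\<sigma> c4 w))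
      (\<lambda>w. sqrt 2 *\<^sub>R (\<sigma> (cl_vec e) (\<sigma> a2 w) - \<sigma> a1 (\<sigma> (cl_vec e) w)))
      (\<lambda>w. 0) (\<lambda>w. - (sqrt 2 *\<^sub>R \<sigma> c4 (\<sigma> (cl_vec e) w)))" for e
  proof -
    obtain f where f: "e = ?B f" using surj by auto
    have comm: "\<rho> (cw_vec (?B f)) w =
        \<rho> (cw_flat f) (\<rho> cw_q w) - \<rho> cw_q (\<rho> (cw_flat f) w)" for w
      using br[of "cw_flat f" cw_q w] by (simp add: G)
    show ?thesis
      unfolding f by (auto simp: comm flat q fun_eq_iff block_def S algebra_simps)
  qed
  (* For a unit vector e = B f, the bracket [f^flat, e] = b(f,e) p acts by zero,
     while its upper right entry is a nonzero multiple of e c4 e. *)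
  have c4: "\<sigma> c4 w = 0" for w
  proof -
    obtain e :: 'e where e: "e \<in> Basis" using nonempty_Basis by blast
    obtain f where f: "e = ?B f" using surj by auto
    have sq: "\<sigma> (cl_vec e) (\<sigma> (cl_vec e) u) = u" for u
      using S(7)[of "cl_vec e" "cl_vec e" u] e
      by (simp add: cl_vec_square S sform_eq_minus_inner)
    have "\<rho> (b f e *\<^sub>R cw_p) (0, u) = 0" for u
      by (simp add: linear_scale[OF lin] p)
    then have "\<rho> (cw_flat f) (\<rho> (cw_vec e) (0, u)) - \<rho> (cw_vec e) (\<rho> (cw_flat f) (0, u)) = 0" for u
      using br[of "cw_flat f" "cw_vec e" "(0, u)"] by (simp add: G)
    then have "- (2 *\<^sub>R \<sigma> (cl_vec e) (\<sigma> c4 (\<sigma> (cl_vec e) u))) =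
        2 *\<^sub>R \<sigma> (cl_vec e) (\<sigma> c4 (\<sigma> (cl_vec e) u))" for u
      by (auto simp: flat vec block_def S f[symmetric] zero_prod_def algebra_simps)
    then have "\<sigma> (cl_vec e) (\<sigma> c4 (\<sigma> (cl_vec e) u)) = 0" for u
      by (simp add: neg_eq_iff_add_eq_0 scaleR_add_left[symmetric])
    from this[of "\<sigma> (cl_vec e) w"] show ?thesis
      by (metis S(12) sq)
  qed
  have "\<sigma> (a1 * (a1 * cl_vec e - cl_vec e * a2) - (a1 * cl_vec e - cl_vec e * a2) * a2)
      = \<sigma> (- cl_vec (?B e))" for e
  proof
    fix w
    have "\<rho> (cw_flat e) (0, w) = \<rho> cw_q (\<rho> (cw_vec e) (0, w)) - \<rho> (cw_vec e) (\<rho> cw_q (0, w))"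
      using br[of cw_q "cw_vec e" "(0, w)"] by (simp add: G)
    then have "sqrt 2 *\<^sub>R \<sigma> (cl_vec (?B e)) w = sqrt 2 *\<^sub>R
        \<sigma> (- (a1 * (a1 * cl_vec e - cl_vec e * a2) - (a1 * cl_vec e - cl_vec e * a2) * a2)) w"
      by (simp add: flat vec q block_def S c4 algebra_simps)
    then show "\<sigma> (a1 * (a1 * cl_vec e - cl_vec e * a2) - (a1 * cl_vec e - cl_vec e * a2) * a2) w
      = \<sigma> (- cl_vec (?B e)) w" by (simp add: S)
  qed
  from quadratic_clifford_eq_lift[OF \<sigma> w0 this]
  obtain c1 c2 where c: "quadratic_clifford_eq b c1 c2" "\<sigma> c1 = \<sigma> a1" "\<sigma> c2 = \<sigma> a2" by blast
  have "\<rho> = triple_rep b \<sigma> c1 c2 c3"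
  proof (intro ext)
    fix x :: "'e cw" and w :: "'s \<times> 's"
    obtain \<xi> e s t where x: "x = (\<xi>, Mink e s t)" by (rule cw_exhaust)
    show "\<rho> x w = triple_rep b \<sigma> c1 c2 c3 x w"
      unfolding x
      by (subst cw_decompose)
        (cases w, simp add: linear_add[OF lin] linear_scale[OF lin] p flat vec q c4 block_def S c scaleR_add_right)
  qed
  then show ?thesis using c(1) by blast
qed

lemma triple_rep_cong:
  assumes \<sigma>: "clifford_rep \<sigma>" and "c1 - d1 \<in> rep_kernel \<sigma>" "c2 - d2 \<in> rep_kernel \<sigma>"
    "c3 - d3 \<in> rep_kernel \<sigma>"
  shows "triple_rep b \<sigma> c1 c2 c3 = triple_rep b \<sigma> d1 d2 d3"
proof
  have "\<sigma> c1 = \<sigma> d1" "\<sigma> c2 = \<sigma> d2" "\<sigma> c3 = \<sigma> d3"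
    using assms by (simp_all add: rep_kernel_def fun_eq_iff clifford_rep_simps[OF \<sigma>])
  then show "triple_rep b \<sigma> c1 c2 c3 x = triple_rep b \<sigma> d1 d2 d3 x" for x
    by (cases x rule: cw_exhaust) simp
qed

theorem theorem4p3:
  fixes n :: nat
    and b :: "'e::neg_euclidean_space \<Rightarrow> 'e \<Rightarrow> real"
    and \<sigma> :: "'e clifford \<Rightarrow> 's::real_vector \<Rightarrow> 's"
  assumes "n \<ge> 2" and "DIM('e) = n - 1"
    and "bilinear b" and "\<forall>x y. b x y = b y x" and "\<forall>x. (\<forall>y. b x y = 0) \<longrightarrow> x = 0"
    and "irreducible_clifford_rep \<sigma>"
  shows "(\<forall>c1 c2 c3. quadratic_clifford_eq b c1 c2 \<longrightarrow>
            zero_charge_spin_rep b \<sigma> (triple_rep b \<sigma> c1 c2 c3)) \<and>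
         (\<forall>\<rho>. zero_charge_spin_rep b \<sigma> \<rho> \<longrightarrow>
            (\<exists>c1 c2 c3. quadratic_clifford_eq b c1 c2 \<and> \<rho> = triple_rep b \<sigma> c1 c2 c3)) \<and>
         (\<forall>c1 c2 c3 d1 d2 d3.
            quadratic_clifford_eq b c1 c2 \<and> quadratic_clifford_eq b d1 d2 \<and>
            c1 - d1 \<in> rep_kernel \<sigma> \<and> c2 - d2 \<in> rep_kernel \<sigma> \<and> c3 - d3 \<in> rep_kernel \<sigma> \<longrightarrow>
            triple_rep b \<sigma> c1 c2 c3 = triple_rep b \<sigma> d1 d2 d3)"
proof -
  obtain w0 :: 's where \<sigma>: "clifford_rep \<sigma>" and w0: "w0 \<noteq> 0"
    using assms(6) unfolding irreducible_clifford_rep_def by blast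
  show ?thesis
    using triple_rep_zero_charge[OF \<sigma> assms(3)] zero_charge_is_triple_rep[OF \<sigma> w0 assms(3,5)]
      triple_rep_cong[OF \<sigma>] by blast
qed

end
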